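(* Let $c_0<0$ and $r>0$, and suppose that $r\Delta_t=\Delta_x^3$. Let $(Y_t)$ be the $\{-1,1\}$-valued Markov chain with transition matrix corresponding to $\alpha_0=\beta_0=1$ and $c_1=c_0$, that is, $$\pi^\Delta=\begin{pmatrix}-c_0\Delta_x & 1+c_0\Delta_x\\ 1+c_0\Delta_x & -c_0\Delta_x\end{pmatrix}.$$ Then the interpolated persistent walk $(\tilde Z^\Delta_t,\ t\ge0)$ converges in law, as $\Delta_x\to0$, to $(\sqrt{-rc_0}\,W_t,\ t\ge0)$, where $(W_t)$ is a standard Brownian motion.
   Context: The rows and columns of $\pi^\Delta$ are ordered as $-1,1$, and $\Delta_x>0$ is small enough that $0\le 1+c_0\Delta_x\le 1$. The initial value $Y_0$ is deterministic, $Y_0=-1$ or $Y_0=1$, and $X_t=\sum_{i=0}^tY_i$ for $t\in\mathbb N$. The normalized walk is $Z^\Delta_s=\Delta_xX_{s/\Delta_t}$ for $s\in\Delta_t\mathbb N$, and $(\tilde Z^\Delta_s)_{s\ge0}$ is the continuous-time process obtained by linear interpolation of $(Z^\Delta_s)_{s\in\Delta_t\mathbb N}$. Convergence in law of processes means weak convergence of laws on the space of continuous functions on $[0,\infty)$ with the topology of uniform convergence on compact sets. *)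

theory Defs
  imports "HOL-Probability.Probability"
begin

section \<open>The path space $C([0,\infty))$\<close>

text \<open>A continuous path is stored as an extensional function on \<open>{0..}\<close>, so that two paths are
  equal as soon as they agree at all nonnegative times.\<close>

typedef cpath = "{f :: real \<Rightarrow> real. continuous_on {0..} f \<and> f \<in> extensional {0..}}"
  morphisms path_val Path
  by (rule exI[of _ "restrict (\<lambda>_. 0) {0..}"])
     (auto intro: continuous_on_eq[of _ "\<lambda>_. 0"])

text \<open>Only meaningful if \<open>f\<close> is continuous on \<open>{0..}\<close>; see \<open>path_val_path_of\<close>.\<close>

definition path_of :: "(real \<Rightarrow> real) \<Rightarrow> cpath" where
  "path_of f = Path (restrict f {0..})"

lemma path_val_path_of:
  assumes "continuous_on {0..} f" "0 \<le> t"
  shows "path_val (path_of f) t = f t"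
proof -
  have "continuous_on {0..} (restrict f {0..})"
    using assms(1) by (rule continuous_on_eq) auto
  then show ?thesis
    using assms(2) by (simp add: path_of_def Path_inverse)
qed

text \<open>The topology of uniform convergence on compact sets. Since compact subsets of $[0,\infty)$
  lie in some \<open>{0..T}\<close>, the sets below, for fixed \<open>f\<close> and varying \<open>T\<close> and \<open>e\<close>, form a
  neighbourhood base at \<open>f\<close>.\<close>

instantiation cpath :: topological_space
begin

definition open_cpath :: "cpath set \<Rightarrow> bool" where
  "open_cpath U \<longleftrightarrow> (\<forall>f\<in>U. \<exists>T e. e > 0 \<and>
     {g. \<forall>t\<in>{0..T}. \<bar>path_val g t - path_val f t\<bar> < e} \<subseteq> U)"

instance
proof
  show "open (UNIV :: cpath set)"
    unfolding open_cpath_def by (auto intro: exI[of _ "1::real"])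
next
  fix U V :: "cpath set"
  assume U: "open U" and V: "open V"
  show "open (U \<inter> V)"
    unfolding open_cpath_def
  proof
    fix f assume f: "f \<in> U \<inter> V"
    obtain S d where S: "d > 0" "{g. \<forall>t\<in>{0..S}. \<bar>path_val g t - path_val f t\<bar> < d} \<subseteq> U"
      using U f unfolding open_cpath_def by blast
    obtain T e where T: "e > 0" "{g. \<forall>t\<in>{0..T}. \<bar>path_val g t - path_val f t\<bar> < e} \<subseteq> V"
      using V f unfolding open_cpath_def by blast
    have "{g. \<forall>t\<in>{0..max S T}. \<bar>path_val g t - path_val f t\<bar> < min d e} \<subseteq> U \<inter> V"
      using S(2) T(2) by fastforce
    moreover have "min d e > 0" using S T by simp
    ultimately show "\<exists>T e. e > 0 \<and>
        {g. \<forall>t\<in>{0..T}. \<bar>path_val g t - path_val f t\<bar> < e} \<subseteq> U \<inter> V"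
      by blast
  qed
next
  fix K :: "cpath set set"
  assume "\<forall>U\<in>K. open U"
  then show "open (\<Union>K)"
    unfolding open_cpath_def by (meson Union_upper Union_iff order_trans)
qed

end


section \<open>Convergence in law\<close>

text \<open>Weak convergence of a family of Borel measures along a filter.\<close>

definition weakly_converges ::
    "('i \<Rightarrow> 'b::topological_space measure) \<Rightarrow> 'b measure \<Rightarrow> 'i filter \<Rightarrow> bool" where
  "weakly_converges \<mu> \<nu> F \<longleftrightarrow>
     (\<forall>\<phi>::'b \<Rightarrow> real. continuous_on UNIV \<phi> \<and> bounded (range \<phi>) \<longrightarrow>
        ((\<lambda>i. integral\<^sup>L (\<mu> i) \<phi>) \<longlongrightarrow> integral\<^sup>L \<nu> \<phi>) F)"

definition path_law :: "'a measure \<Rightarrow> (real \<Rightarrow> 'a \<Rightarrow> real) \<Rightarrow> cpath measure" where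
  "path_law M Z = distr M borel (\<lambda>\<omega>. path_of (\<lambda>t. Z t \<omega>))"


section \<open>Markov chains and Brownian motion\<close>

definition markov_chain ::
    "'a measure \<Rightarrow> 's set \<Rightarrow> ('s \<Rightarrow> 's \<Rightarrow> real) \<Rightarrow> (nat \<Rightarrow> 'a \<Rightarrow> 's) \<Rightarrow> bool" where
  "markov_chain M S P Y \<longleftrightarrow>
     prob_space M \<and>
     (\<forall>n. Y n \<in> M \<rightarrow>\<^sub>M count_space S) \<and>
     (\<forall>n y. \<forall>j\<in>S. \<P>(\<omega> in M. \<forall>i\<le>n. Y i \<omega> = y i) > 0 \<longrightarrow>
        \<P>(\<omega> in M. Y (Suc n) \<omega> = j \<bar> \<forall>i\<le>n. Y i \<omega> = y i) = P (y n) j)"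

definition standard_brownian_motion :: "'a measure \<Rightarrow> (real \<Rightarrow> 'a \<Rightarrow> real) \<Rightarrow> bool" where
  "standard_brownian_motion M W \<longleftrightarrow>
     prob_space M \<and>
     (\<forall>t\<ge>0. W t \<in> borel_measurable M) \<and>
     (AE \<omega> in M. W 0 \<omega> = 0) \<and>
     (\<forall>\<omega>\<in>space M. continuous_on {0..} (\<lambda>t. W t \<omega>)) \<and>
     (\<forall>s t. 0 \<le> s \<and> s < t \<longrightarrow>
        distributed M lborel (\<lambda>\<omega>. W t \<omega> - W s \<omega>) (normal_density 0 (sqrt (t - s)))) \<and>
     (\<forall>n (t :: nat \<Rightarrow> real). 0 \<le> t 0 \<and> (\<forall>i<n. t i \<le> t (Suc i)) \<longrightarrow>
        prob_space.indep_vars M (\<lambda>_. borel) (\<lambda>i \<omega>. W (t (Suc i)) \<omega> - W (t i) \<omega>) {..<n})"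


section \<open>The interpolated persistent walk\<close>

text \<open>The transition matrix on the states $-1$ and $1$; it is symmetric with constant diagonal.\<close>

definition persistent_matrix :: "real \<Rightarrow> real \<Rightarrow> int \<Rightarrow> int \<Rightarrow> real" where
  "persistent_matrix c0 dx i j = (if i = j then - c0 * dx else 1 + c0 * dx)"

definition walk :: "(nat \<Rightarrow> 'a \<Rightarrow> int) \<Rightarrow> nat \<Rightarrow> 'a \<Rightarrow> int" where
  "walk Y t \<omega> = (\<Sum>i\<le>t. Y i \<omega>)"

text \<open>Piecewise linear interpolation of the values \<open>z k\<close> placed at the times \<open>real k * dt\<close>.\<close>

definition linear_interpolation :: "real \<Rightarrow> (nat \<Rightarrow> real) \<Rightarrow> real \<Rightarrow> real" where
  "linear_interpolation dt z s =
     (let k = nat \<lfloor>s / dt\<rfloor> in z k + (s / dt - real k) * (z (Suc k) - z k))"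

definition interpolated_walk ::
    "real \<Rightarrow> real \<Rightarrow> (nat \<Rightarrow> 'a \<Rightarrow> int) \<Rightarrow> real \<Rightarrow> 'a \<Rightarrow> real" where
  "interpolated_walk dx dt Y s \<omega> =
     linear_interpolation dt (\<lambda>k. dx * of_int (walk Y k \<omega>)) s"

end

theory Submission
  imports Defs
begin

text \<open>Write $p = -c_0 \Delta_x$ for the probability that the chain repeats its state. Since $p$ is
  small, the chain almost alternates, and the walk is a bounded perturbation of a martingale: with
  $\rho = 2p - 1$ the process $X_n + \frac{\rho}{1-\rho} Y_n$ is a martingale with bounded
  increments, and the correction vanishes after multiplication by $\Delta_x$. An increment of this
  martingale is $Y$ (after a repetition) or $-Y p/(1-p)$ (after a flip), $Y$ being the current
  state, so its conditional variance is the constant $p/(1-p)$, whatever the past. Over a time $t$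
  there are $r t/\Delta_x^3$ steps and the total variance of the rescaled martingale is about
  $\Delta_x^2 \cdot r t \Delta_x^{-3} \cdot (-c_0 \Delta_x) = -r c_0 t$, which is the variance of the
  limit.

  The deterministic conditional variance gives, by a one-step recursion, a characteristic function
  that is Gaussian up to an error of order $\Delta_x$ (\<open>mart_char\<close>), hence by Levy's theorem a
  central limit theorem for the walk started in either state (\<open>walk_clt\<close>). It also gives a maximal
  inequality with a fourth power (\<open>mart_maximal\<close>), because an explicit quartic polynomial in the
  position is a supermartingale.

  On path space it suffices to test weak convergence on bounded
  functionals that are Lipschitz for a uniform norm on some $[0,k]$, since every bounded continuous
  functional is a pointwise limit of such functionals from below (\<open>weakly_converges_lipschitzI\<close>).
  For such a functional, a path may be replaced by its linear interpolation on a coarse grid of mesh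
  $1/m$ (\<open>walk_functional_near_grid\<close>): the error is governed by the oscillation inside the
  blocks, and the maximal inequality bounds the probability of a large oscillation by $O(1/m^2)$ for
  each of the $O(m)$ blocks. On the coarse grid only finitely many increments matter. They are
  replaced by independent Gaussian ones, the last block first (\<open>block_increments_limit\<close>): given the
  past, the increment over a block depends only on the current state, which has two possible values,
  and Skorohod's representation makes the central limit theorem uniform over bounded Lipschitz test
  functions. Finally the interpolations of the Brownian path converge to the path itself.\<close>

section \<open>Piecewise linear interpolation\<close>

text \<open>The contribution of each increment is a clamped affine function of time, so that continuity
  across the nodes needs no case distinction.\<close>

lemma linear_interpolation_eq_clamps:
  assumes "dt > 0" "0 \<le> s" "s < real n * dt"
  shows "linear_interpolation dt z s =
     z 0 + (\<Sum>k<n. (z (Suc k) - z k) * max 0 (min 1 (s / dt - real k)))"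
proof -
  define u where "u = s / dt"
  define j where "j = nat \<lfloor>u\<rfloor>"
  have u: "0 \<le> u" "u < real n" using assms by (auto simp: u_def field_simps)
  have j: "real j \<le> u" "u < real j + 1" using u(1) unfolding j_def by auto
  have jn: "j < n" using j u by linarith
  have "(\<Sum>k<n. (z (Suc k) - z k) * max 0 (min 1 (u - real k)))
      = (\<Sum>k<n. if k < j then z (Suc k) - z k else if k = j then (u - j) * (z (Suc j) - z j) else 0)"
    using j by (intro sum.cong) (auto simp: max_def min_def)
  also have "\<dots> = (\<Sum>k<Suc j. if k < j then z (Suc k) - z k else if k = j then (u - j) * (z (Suc j) - z j) else 0)"
    using jn by (intro sum.mono_neutral_right) auto
  also have "\<dots> = (\<Sum>k<j. z (Suc k) - z k) + (u - j) * (z (Suc j) - z j)"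
    by simp
  also have "(\<Sum>k<j. z (Suc k) - z k) = z j - z 0" by (rule sum_lessThan_telescope)
  finally show ?thesis unfolding linear_interpolation_def Let_def u_def[symmetric] j_def[symmetric] by simp
qed

lemma continuous_on_linear_interpolation:
  assumes "dt > 0" shows "continuous_on {0..} (linear_interpolation dt z)"
proof -
  have "continuous (at s within {0..}) (linear_interpolation dt z)" if s: "s \<in> {0..}" for s
  proof -
    obtain n where "s / dt < real n" using reals_Archimedean2 by blast
    then have n: "s < real n * dt" using assms by (simp add: field_simps)
    let ?f = "\<lambda>s. z 0 + (\<Sum>k<n. (z (Suc k) - z k) * max 0 (min 1 (s / dt - real k)))"
    have "continuous (at s within {0..}) ?f"
      using continuous_on_eq_continuous_within[of "{0..}" ?f] s assms
      by (auto intro!: continuous_intros)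
    moreover have "\<forall>\<^sub>F x in at s within {0..}. ?f x = linear_interpolation dt z x"
    proof -
      have "\<forall>\<^sub>F x in at s within {0..}. x < real n * dt"
        using n by (intro order_tendstoD(2)[OF tendsto_ident_at])
      moreover have "\<forall>\<^sub>F x in at s within {0..}. x \<in> {0..}"
        by (auto simp: eventually_at_filter)
      ultimately show ?thesis
        by eventually_elim (simp add: linear_interpolation_eq_clamps[OF assms])
    qed
    moreover have "?f s = linear_interpolation dt z s"
      using linear_interpolation_eq_clamps[OF assms _ n, of z] s by simp
    ultimately show ?thesis
      unfolding continuous_within using tendsto_cong by fastforce
  qed
  then show ?thesis by (simp add: continuous_on_eq_continuous_within)
qed

text \<open>Between two nodes the interpolation is a convex combination of the two nodal values, so
  it is at least as close to any given number as the worse of the two.\<close>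

lemma linear_interpolation_near:
  assumes "dt > 0" "0 \<le> s" and j: "j = nat \<lfloor>s / dt\<rfloor>"
    and "\<bar>z j - c\<bar> \<le> e" "\<bar>z (Suc j) - c\<bar> \<le> e"
  shows "\<bar>linear_interpolation dt z s - c\<bar> \<le> e"
proof -
  define th where "th = s / dt - real j"
  have "0 \<le> s / dt" using assms by simp
  then have th: "0 \<le> th" "th \<le> 1" unfolding th_def j by linarith+
  have "linear_interpolation dt z s - c = (1 - th) * (z j - c) + th * (z (Suc j) - c)"
    unfolding linear_interpolation_def Let_def j[symmetric] th_def[symmetric] by (simp add: algebra_simps)
  also have "\<bar>\<dots>\<bar> \<le> (1 - th) * \<bar>z j - c\<bar> + th * \<bar>z (Suc j) - c\<bar>"
    using th by (intro order_trans[OF abs_triangle_ineq]) (simp add: abs_mult)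
  also have "\<dots> \<le> (1 - th) * e + th * e"
    using th assms by (intro add_mono mult_left_mono) auto
  finally show ?thesis by (simp add: algebra_simps)
qed

lemma linear_interpolation_diff:
  "linear_interpolation dt (\<lambda>k. z k - w k) s = linear_interpolation dt z s - linear_interpolation dt w s"
  by (simp add: linear_interpolation_def Let_def algebra_simps)

lemma linear_interpolation_close:
  assumes "dt > 0" "0 \<le> s" "s \<le> real n * dt" "\<And>k. k \<le> Suc n \<Longrightarrow> \<bar>z k - w k\<bar> \<le> e"
  shows "\<bar>linear_interpolation dt z s - linear_interpolation dt w s\<bar> \<le> e"
proof -
  have "s / dt \<le> real n" using assms by (simp add: field_simps)
  then have "nat \<lfloor>s / dt\<rfloor> \<le> n" by (simp add: floor_le_iff nat_le_iff)
  then show ?thesis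
    using linear_interpolation_near[OF assms(1,2) refl, of "\<lambda>k. z k - w k" 0 e] assms(4)
    by (simp add: linear_interpolation_diff)
qed

text \<open>Uniform continuity on \<open>{0..T+1}\<close>; the extra unit of time leaves room for the node to the right
  of a time close to \<open>T\<close>.\<close>

lemma linear_interpolation_of_continuous_close:
  assumes f: "continuous_on {0..} f" and e: "e > 0"
  shows "\<forall>\<^sub>F m in sequentially. \<forall>t\<in>{0..T}.
           \<bar>linear_interpolation (1 / real (Suc m)) (\<lambda>k. f (real k / real (Suc m))) t - f t\<bar> \<le> e"
proof -
  have "uniformly_continuous_on {0..T+1} f"
    by (rule compact_uniformly_continuous) (auto intro: continuous_on_subset[OF f])
  then obtain d where d: "d > 0" "\<And>x y. x \<in> {0..T+1} \<Longrightarrow> y \<in> {0..T+1} \<Longrightarrow> \<bar>x - y\<bar> < d \<Longrightarrow> \<bar>f x - f y\<bar> < e"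
    unfolding uniformly_continuous_on_def dist_real_def using e by metis
  have "\<forall>\<^sub>F m in sequentially. 1 / real (Suc m) < d"
    using d(1) LIMSEQ_inverse_real_of_nat by (intro order_tendstoD) (auto simp: inverse_eq_divide)
  then show ?thesis
  proof eventually_elim
    case (elim m)
    show ?case
    proof
      fix t assume t: "t \<in> {0..T}"
      define j where "j = nat \<lfloor>t / (1 / real (Suc m))\<rfloor>"
      have "0 \<le> t * real (Suc m)" using t by simp
      then have j: "real j \<le> t * real (Suc m)" "t * real (Suc m) < real j + 1"
        unfolding j_def by auto
      have 1: "real j / real (Suc m) \<le> t" "t - real j / real (Suc m) < 1 / real (Suc m)"
        "real (Suc j) / real (Suc m) - t \<le> 1 / real (Suc m)" "t \<le> real (Suc j) / real (Suc m)"
      proof -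
        define n where "n = real (Suc m)"
        have "n > 0" by (simp add: n_def)
        then have "t < (real j + 1) / n" using j unfolding n_def[symmetric] by (simp add: field_simps)
        then show "t - real j / real (Suc m) < 1 / real (Suc m)"
          unfolding n_def[symmetric] by (simp add: add_divide_distrib)
        from \<open>n > 0\<close> show "real j / real (Suc m) \<le> t"
          "real (Suc j) / real (Suc m) - t \<le> 1 / real (Suc m)" "t \<le> real (Suc j) / real (Suc m)"
          using j unfolding n_def[symmetric] by (simp_all add: field_simps)
      qed
      have 2: "1 / real (Suc m) \<le> 1" by simp
      have 3: "0 \<le> real j / real (Suc m)" "0 \<le> real (Suc j) / real (Suc m)" by simp_all
      have "\<bar>f (real j / real (Suc m)) - f t\<bar> < e" "\<bar>f (real (Suc j) / real (Suc m)) - f t\<bar> < e"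
        using 1 2 3 t elim by (intro d(2); simp only: atLeastAtMost_iff; linarith)+
      then show "\<bar>linear_interpolation (1 / real (Suc m)) (\<lambda>k. f (real k / real (Suc m))) t - f t\<bar> \<le> e"
        using t by (intro linear_interpolation_near[OF _ _ j_def]) auto
    qed
  qed
qed

section \<open>Functionals that are Lipschitz for a uniform norm\<close>

lemma continuous_on_path_val: "continuous_on {0..} (path_val f)"
  using path_val[of f] by simp

text \<open>Quantifying over the bounds \<open>e\<close> of the uniform distance, instead of naming a supremum, lets
  pointwise estimates of paths be used directly.\<close>

definition path_lipschitz :: "real \<Rightarrow> real \<Rightarrow> (cpath \<Rightarrow> real) \<Rightarrow> bool" where
  "path_lipschitz T L \<phi> \<longleftrightarrow>
     (\<forall>f g e. (\<forall>t\<in>{0..T}. \<bar>path_val f t - path_val g t\<bar> \<le> e) \<longrightarrow> \<bar>\<phi> f - \<phi> g\<bar> \<le> L * e)"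

lemma path_lipschitzD:
  "path_lipschitz T L \<phi> \<Longrightarrow> (\<And>t. 0 \<le> t \<Longrightarrow> t \<le> T \<Longrightarrow> \<bar>path_val f t - path_val g t\<bar> \<le> e) \<Longrightarrow> \<bar>\<phi> f - \<phi> g\<bar> \<le> L * e"
  by (auto simp: path_lipschitz_def)

text \<open>The filter is arbitrary because convergence is needed along neighbourhoods of a path, along
  neighbourhoods of a sequence of nodal values, and along refining grids.\<close>

lemma path_lipschitz_tendsto:
  assumes \<phi>: "path_lipschitz T L \<phi>" "L \<ge> 0"
    and F: "\<And>e. e > 0 \<Longrightarrow> \<forall>\<^sub>F n in F. \<forall>t\<in>{0..T}. \<bar>path_val (f n) t - path_val g t\<bar> \<le> e"
  shows "((\<lambda>n. \<phi> (f n)) \<longlongrightarrow> \<phi> g) F"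
proof (rule tendstoI)
  fix e :: real assume e: "e > 0"
  have "e / (L + 1) > 0" using e assms by simp
  from F[OF this] show "\<forall>\<^sub>F n in F. dist (\<phi> (f n)) (\<phi> g) < e"
  proof eventually_elim
    case (elim n)
    then have "\<bar>\<phi> (f n) - \<phi> g\<bar> \<le> L * (e / (L + 1))"
      using \<phi>(1) unfolding path_lipschitz_def by blast
    also have "\<dots> < e" using e \<phi>(2) by (simp add: field_simps)
    finally show ?case by (simp add: dist_real_def)
  qed
qed

lemma eventually_nhds_cpath:
  fixes g :: cpath assumes "e > 0"
  shows "\<forall>\<^sub>F f in nhds g. \<forall>t\<in>{0..T}. \<bar>path_val f t - path_val g t\<bar> \<le> e"
proof -
  \<comment> \<open>The set of paths whose distance to \<open>g\<close> on \<open>{0..T}\<close> stays below some \<open>e' < e\<close> is open: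
     shrink the tolerance by the amount already used.\<close>
  define U where "U = {f. \<exists>e'<e. \<forall>t\<in>{0..T}. \<bar>path_val f t - path_val g t\<bar> \<le> e'}"
  have "open U" unfolding open_cpath_def
  proof
    fix f assume "f \<in> U"
    then obtain e' where e': "e' < e" "\<forall>t\<in>{0..T}. \<bar>path_val f t - path_val g t\<bar> \<le> e'" by (auto simp: U_def)
    have "{h. \<forall>t\<in>{0..T}. \<bar>path_val h t - path_val f t\<bar> < (e - e') / 2} \<subseteq> U"
    proof
      fix h assume h: "h \<in> {h. \<forall>t\<in>{0..T}. \<bar>path_val h t - path_val f t\<bar> < (e - e') / 2}"
      have "\<bar>path_val h t - path_val g t\<bar> \<le> (e + e') / 2" if t: "t \<in> {0..T}" for t
      proof -
        have "\<bar>path_val h t - path_val f t\<bar> < (e - e') / 2" using h t by blast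
        moreover have "\<bar>path_val f t - path_val g t\<bar> \<le> e'" using e'(2) t by blast
        ultimately have "\<bar>path_val h t - path_val g t\<bar> \<le> (e - e') / 2 + e'" by linarith
        then show ?thesis by (simp add: field_simps)
      qed
      moreover have "(e + e') / 2 < e" using e' by simp
      ultimately show "h \<in> U" unfolding U_def by blast
    qed
    moreover have "(e - e') / 2 > 0" using e' by simp
    ultimately show "\<exists>T e. e > 0 \<and> {h. \<forall>t\<in>{0..T}. \<bar>path_val h t - path_val f t\<bar> < e} \<subseteq> U" by blast
  qed
  moreover have "g \<in> U" using assms by (auto simp: U_def intro!: exI[of _ 0])
  moreover have "U \<subseteq> {f. \<forall>t\<in>{0..T}. \<bar>path_val f t - path_val g t\<bar> \<le> e}"
    by (force simp: U_def)
  ultimately show ?thesis unfolding eventually_nhds by blast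
qed

lemma path_lipschitz_continuous:
  assumes "path_lipschitz T L \<phi>" "L \<ge> 0" shows "continuous_on UNIV \<phi>"
proof -
  have "(\<phi> \<longlongrightarrow> \<phi> g) (at g)" for g
    by (rule path_lipschitz_tendsto[OF assms])
       (auto simp: eventually_at_filter intro!: eventually_mono[OF eventually_nhds_cpath])
  then show ?thesis by (simp add: continuous_on_def)
qed

definition unif_dist :: "nat \<Rightarrow> cpath \<Rightarrow> cpath \<Rightarrow> real" where
  "unif_dist k f g = (SUP t\<in>{0..real k}. \<bar>path_val f t - path_val g t\<bar>)"

text \<open>The Lipschitz regularisation (inf-convolution) of a functional, for the uniform distance on
  \<open>{0..k}\<close> and slope \<open>k\<close>. The two roles of \<open>k\<close> let the horizon and the slope grow together,
  in accordance with a neighbourhood base given by horizons and tolerances.\<close>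

definition lipschitz_below :: "nat \<Rightarrow> (cpath \<Rightarrow> real) \<Rightarrow> cpath \<Rightarrow> real" where
  "lipschitz_below k \<phi> f = (INF g. \<phi> g + real k * unif_dist k f g)"

lemma unif_dist_bound: "t \<in> {0..real k} \<Longrightarrow> \<bar>path_val f t - path_val g t\<bar> \<le> unif_dist k f g"
  unfolding unif_dist_def
proof (rule cSUP_upper)
  have "compact ((\<lambda>t. \<bar>path_val f t - path_val g t\<bar>) ` {0..real k})"
    by (intro compact_continuous_image continuous_intros continuous_on_subset[OF continuous_on_path_val]) auto
  then show "bdd_above ((\<lambda>t. \<bar>path_val f t - path_val g t\<bar>) ` {0..real k})"
    by (intro bounded_imp_bdd_above compact_imp_bounded)
qed

lemma unif_dist_least: "(\<And>t. t \<in> {0..real k} \<Longrightarrow> \<bar>path_val f t - path_val g t\<bar> \<le> e) \<Longrightarrow> unif_dist k f g \<le> e"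
  unfolding unif_dist_def by (rule cSUP_least) auto

lemma unif_dist_nonneg: "0 \<le> unif_dist k f g"
  using order_trans[OF abs_ge_zero unif_dist_bound[of 0 k f g]] by simp

lemma unif_dist_self: "unif_dist k f f = 0"
  using unif_dist_nonneg[of k f f] unif_dist_least[of k f f 0] by simp

context
  fixes \<phi> :: "cpath \<Rightarrow> real" and C :: real
  assumes bound: "\<And>f. \<bar>\<phi> f\<bar> \<le> C"
begin

lemma lipschitz_below_lower: "- C \<le> \<phi> g + real k * unif_dist k f g"
  using bound[of g] unif_dist_nonneg[of k f g] by (smt (verit) mult_nonneg_nonneg of_nat_0_le_iff)

lemma bdd_below_lipschitz_below: "bdd_below (range (\<lambda>g. \<phi> g + real k * unif_dist k f g))"
  using lipschitz_below_lower by (auto simp: bdd_below_def)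

lemma lipschitz_below_le: "lipschitz_below k \<phi> f \<le> \<phi> g + real k * unif_dist k f g"
  unfolding lipschitz_below_def by (rule cINF_lower[OF bdd_below_lipschitz_below]) simp

lemma lipschitz_below_le_self: "lipschitz_below k \<phi> f \<le> \<phi> f"
  using lipschitz_below_le[of k f f] by (simp add: unif_dist_self)

lemma lipschitz_below_bound: "\<bar>lipschitz_below k \<phi> f\<bar> \<le> C"
proof -
  have "- C \<le> lipschitz_below k \<phi> f"
    unfolding lipschitz_below_def by (rule cINF_greatest) (auto simp: lipschitz_below_lower)
  moreover have "lipschitz_below k \<phi> f \<le> C"
    using lipschitz_below_le_self[of k f] bound[of f] by linarith
  ultimately show ?thesis by linarith
qed

text \<open>For each competitor \<open>h\<close> in the infimum, moving \<open>f\<close> to \<open>g\<close> changes the penalty by at most \<open>k\<close>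
  times the distance between \<open>f\<close> and \<open>g\<close>.\<close>

lemma path_lipschitz_lipschitz_below: "path_lipschitz (real k) (real k) (lipschitz_below k \<phi>)"
proof -
  have *: "lipschitz_below k \<phi> f \<le> lipschitz_below k \<phi> g + real k * e"
    if h: "\<forall>t\<in>{0..real k}. \<bar>path_val f t - path_val g t\<bar> \<le> e" for f g e
  proof -
    have "lipschitz_below k \<phi> f - real k * e \<le> \<phi> h + real k * unif_dist k g h" for h
    proof -
      have "unif_dist k f h \<le> e + unif_dist k g h"
      proof (rule unif_dist_least)
        fix t assume "t \<in> {0..real k}"
        then show "\<bar>path_val f t - path_val h t\<bar> \<le> e + unif_dist k g h"
          using h unif_dist_bound[of t k g h] by (smt (verit))
      qed
      then have "real k * unif_dist k f h \<le> real k * (e + unif_dist k g h)"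
        by (intro mult_left_mono) auto
      then show ?thesis using lipschitz_below_le[of k f h] by (simp add: algebra_simps)
    qed
    then have "lipschitz_below k \<phi> f - real k * e \<le> lipschitz_below k \<phi> g"
      unfolding lipschitz_below_def[of k \<phi> g] by (intro cINF_greatest) auto
    then show ?thesis by simp
  qed
  show ?thesis unfolding path_lipschitz_def
  proof (intro allI impI)
    fix f g e assume h: "\<forall>t\<in>{0..real k}. \<bar>path_val f t - path_val g t\<bar> \<le> e"
    then have "\<forall>t\<in>{0..real k}. \<bar>path_val g t - path_val f t\<bar> \<le> e" by (simp add: abs_minus_commute)
    from *[OF h] *[OF this] show "\<bar>lipschitz_below k \<phi> f - lipschitz_below k \<phi> g\<bar> \<le> real k * e" by linarith
  qed
qed

text \<open>A competitor outside the neighbourhood of \<open>f\<close> is at distance at least \<open>e\<close>, so its penalty, at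
  least \<open>k * e\<close>, eventually outweighs the bounded functional. The hypothesis is lower
  semicontinuity at \<open>f\<close>, which covers continuous functionals and indicators of open sets alike.\<close>

lemma lipschitz_below_tendsto:
  assumes lsc: "\<And>a. a < \<phi> f \<Longrightarrow> \<exists>T e. e > 0 \<and> {g. \<forall>t\<in>{0..T}. \<bar>path_val g t - path_val f t\<bar> < e} \<subseteq> {g. a < \<phi> g}"
  shows "(\<lambda>k. lipschitz_below k \<phi> f) \<longlonglongrightarrow> \<phi> f"
proof (rule order_tendstoI)
  fix a assume "\<phi> f < a"
  then show "\<forall>\<^sub>F k in sequentially. lipschitz_below k \<phi> f < a"
    by (auto intro!: always_eventually le_less_trans[OF lipschitz_below_le_self])
next
  fix a assume a: "a < \<phi> f"
  then obtain b where b: "a < b" "b < \<phi> f" using dense by blast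
  obtain T e where Te: "e > 0" "{g. \<forall>t\<in>{0..T}. \<bar>path_val g t - path_val f t\<bar> < e} \<subseteq> {g. b < \<phi> g}"
    using lsc[OF b(2)] by blast
  obtain k0 where k0: "real k0 \<ge> max T ((\<phi> f + C) / e)" using real_arch_simple by blast
  have "a < lipschitz_below k \<phi> f" if k: "k \<ge> k0" for k
  proof -
    have kT: "T \<le> real k" "(\<phi> f + C) / e \<le> real k" using k0 k by linarith+
    have "b \<le> \<phi> g + real k * unif_dist k f g" for g
    proof (cases "unif_dist k f g < e")
      case True
      have "\<bar>path_val g t - path_val f t\<bar> < e" if "t \<in> {0..T}" for t
        using unif_dist_bound[of t k f g] that kT True by auto
      then have "b < \<phi> g" using Te(2) by blast
      then show ?thesis using unif_dist_nonneg[of k f g] by (smt (verit) mult_nonneg_nonneg of_nat_0_le_iff)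
    next
      case False
      have "\<phi> f + C \<le> real k * e" using kT(2) Te(1) by (simp add: field_simps)
      also have "\<dots> \<le> real k * unif_dist k f g" using False by (intro mult_left_mono) auto
      finally show ?thesis using bound[of g] b(2) by linarith
    qed
    then have "b \<le> lipschitz_below k \<phi> f" unfolding lipschitz_below_def by (intro cINF_greatest) auto
    then show ?thesis using b by simp
  qed
  then show "\<forall>\<^sub>F k in sequentially. a < lipschitz_below k \<phi> f"
    unfolding eventually_sequentially by blast
qed

end

section \<open>Laws on path space\<close>

text \<open>Only finitely many nodes influence a path on \<open>{0..T}\<close>, so the functional is continuous for the
  product topology on sequences, whose Borel sets are those of the product sigma-algebra.\<close>

lemma lipschitz_interpolation_measurable:
  assumes \<psi>: "path_lipschitz T L \<psi>" "L \<ge> 0" and dt: "dt > 0"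
  shows "(\<lambda>x :: nat \<Rightarrow> real. \<psi> (path_of (linear_interpolation dt x))) \<in> borel_measurable borel"
proof (rule borel_measurable_continuous_onI)
  have "((\<lambda>y. \<psi> (path_of (linear_interpolation dt y))) \<longlongrightarrow> \<psi> (path_of (linear_interpolation dt x))) (at x)"
    for x :: "nat \<Rightarrow> real"
  proof (rule path_lipschitz_tendsto[OF \<psi>])
    fix e :: real assume e: "e > 0"
    obtain n where "T / dt \<le> real n" using real_arch_simple by blast
    then have n: "T \<le> real n * dt" using dt by (simp add: field_simps)
    have "\<forall>\<^sub>F y in at x. \<bar>y k - x k\<bar> \<le> e" for k
    proof -
      have "((\<lambda>y :: nat \<Rightarrow> real. y k) \<longlongrightarrow> x k) (at x)"
        using continuous_on_product_coordinates[of k]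
        by (auto simp: continuous_on_def)
      from tendstoD[OF this e] show ?thesis
        by eventually_elim (simp add: dist_real_def)
    qed
    then have "\<forall>\<^sub>F y in at x. \<forall>k\<in>{..Suc n}. \<bar>y k - x k\<bar> \<le> e"
      by (intro eventually_ball_finite) auto
    then show "\<forall>\<^sub>F y in at x. \<forall>t\<in>{0..T}. \<bar>path_val (path_of (linear_interpolation dt y)) t
                   - path_val (path_of (linear_interpolation dt x)) t\<bar> \<le> e"
    proof eventually_elim
      case (elim y)
      show ?case
      proof
        fix t assume t: "t \<in> {0..T}"
        have "\<bar>linear_interpolation dt y t - linear_interpolation dt x t\<bar> \<le> e"
          by (rule linear_interpolation_close[OF dt, of t n]) (use t n elim in auto)
        then show "\<bar>path_val (path_of (linear_interpolation dt y)) t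
                   - path_val (path_of (linear_interpolation dt x)) t\<bar> \<le> e"
          using t by (simp add: path_val_path_of continuous_on_linear_interpolation[OF dt])
      qed
    qed
  qed
  then show "continuous_on UNIV (\<lambda>x :: nat \<Rightarrow> real. \<psi> (path_of (linear_interpolation dt x)))"
    by (simp add: continuous_on_def)
qed

lemma lipschitz_interpolation_tendsto:
  assumes \<psi>: "path_lipschitz T L \<psi>" "L \<ge> 0" and f: "continuous_on {0..} f"
  shows "(\<lambda>m. \<psi> (path_of (linear_interpolation (1 / real (Suc m)) (\<lambda>k. f (real k / real (Suc m))))))
           \<longlonglongrightarrow> \<psi> (path_of f)"
proof (rule path_lipschitz_tendsto[OF \<psi>])
  fix e :: real assume "e > 0"
  from linear_interpolation_of_continuous_close[OF f this, of T]
  show "\<forall>\<^sub>F m in sequentially. \<forall>t\<in>{0..T}. \<bar>path_val (path_of (linear_interpolation (1 / real (Suc m))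
            (\<lambda>k. f (real k / real (Suc m))))) t - path_val (path_of f) t\<bar> \<le> e"
    by eventually_elim (simp add: path_val_path_of continuous_on_linear_interpolation f)
qed

text \<open>Measurability is reached through Lipschitz functionals: such a functional of the process is the
  limit of its values on interpolations, which depend on countably many coordinates. Open sets are
  then recovered from their Lipschitz regularisations.\<close>

lemma measurable_path_of:
  assumes Z: "\<And>t. t \<ge> 0 \<Longrightarrow> Z t \<in> borel_measurable M"
    and cont: "\<And>\<omega>. \<omega> \<in> space M \<Longrightarrow> continuous_on {0..} (\<lambda>t. Z t \<omega>)"
  shows "(\<lambda>\<omega>. path_of (\<lambda>t. Z t \<omega>)) \<in> M \<rightarrow>\<^sub>M borel"
proof (rule borel_measurableI)
  fix U :: "cpath set" assume U: "open U"
  let ?F = "\<lambda>\<omega>. path_of (\<lambda>t. Z t \<omega>)"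
  have meas: "(\<lambda>\<omega>. \<psi> (?F \<omega>)) \<in> borel_measurable M" if \<psi>: "path_lipschitz T L \<psi>" "L \<ge> 0" for T L \<psi>
  proof (rule borel_measurable_LIMSEQ_real)
    fix \<omega> assume "\<omega> \<in> space M"
    then show "(\<lambda>m. \<psi> (path_of (linear_interpolation (1 / real (Suc m)) (\<lambda>k. Z (real k / real (Suc m)) \<omega>))))
           \<longlonglongrightarrow> \<psi> (?F \<omega>)"
      using lipschitz_interpolation_tendsto[OF \<psi> cont] by blast
  next
    fix m
    show "(\<lambda>\<omega>. \<psi> (path_of (linear_interpolation (1 / real (Suc m)) (\<lambda>k. Z (real k / real (Suc m)) \<omega>))))
      \<in> borel_measurable M"
      by (rule measurable_compose[OF _ lipschitz_interpolation_measurable[OF \<psi>]],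
          rule measurable_coordinatewise_then_product) (auto intro: Z)
  qed
  \<comment> \<open>The indicator of an open set is the supremum of its Lipschitz regularisations.\<close>
  have bnd: "\<bar>indicator U f\<bar> \<le> (1::real)" for f by (simp add: indicator_def)
  have pos: "?F \<omega> \<in> U \<longleftrightarrow> (\<exists>k. 0 < lipschitz_below k (indicator U) (?F \<omega>))" for \<omega>
  proof
    assume F: "?F \<omega> \<in> U"
    have "(\<lambda>k. lipschitz_below k (indicator U) (?F \<omega>)) \<longlonglongrightarrow> indicator U (?F \<omega>)"
    proof (rule lipschitz_below_tendsto[OF bnd])
      fix a :: real assume a: "a < indicator U (?F \<omega>)"
      then have "U \<subseteq> {g. a < indicator U g}" using F by auto
      then show "\<exists>T e. e > 0 \<and> {g. \<forall>t\<in>{0..T}. \<bar>path_val g t - path_val (?F \<omega>) t\<bar> < e} \<subseteq> {g. a < indicator U g}"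
        using U F unfolding open_cpath_def by (meson order_trans)
    qed
    from order_tendstoD(1)[OF this, of 0] F show "\<exists>k. 0 < lipschitz_below k (indicator U) (?F \<omega>)"
      by (auto simp: eventually_sequentially)
  next
    assume "\<exists>k. 0 < lipschitz_below k (indicator U) (?F \<omega>)"
    then obtain k where "0 < lipschitz_below k (indicator U) (?F \<omega>)" ..
    also have "\<dots> \<le> indicator U (?F \<omega>)" by (rule lipschitz_below_le_self[OF bnd])
    finally show "?F \<omega> \<in> U" by (auto simp: indicator_def split: if_splits)
  qed
  have [measurable]: "(\<lambda>\<omega>. lipschitz_below k (indicator U) (?F \<omega>)) \<in> borel_measurable M" for k
    by (rule meas[OF path_lipschitz_lipschitz_below[OF bnd]]) simp
  have "?F -` U \<inter> space M = {\<omega> \<in> space M. \<exists>k. 0 < lipschitz_below k (indicator U) (?F \<omega>)}"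
    using pos by auto
  also have "\<dots> \<in> sets M" by measurable
  finally show "?F -` U \<inter> space M \<in> sets M" .
qed

lemma sets_path_law [simp]: "sets (path_law M Z) = sets borel"
  by (simp add: path_law_def)

lemma integral_path_law:
  assumes "\<And>t. t \<ge> 0 \<Longrightarrow> Z t \<in> borel_measurable M"
    "\<And>\<omega>. \<omega> \<in> space M \<Longrightarrow> continuous_on {0..} (\<lambda>t. Z t \<omega>)"
    and \<phi>: "path_lipschitz T L \<phi>" "L \<ge> 0"
  shows "integral\<^sup>L (path_law M Z) \<phi> = (\<integral>\<omega>. \<phi> (path_of (\<lambda>t. Z t \<omega>)) \<partial>M)"
    and "(\<lambda>\<omega>. \<phi> (path_of (\<lambda>t. Z t \<omega>))) \<in> borel_measurable M"
proof -
  have 1: "(\<lambda>\<omega>. path_of (\<lambda>t. Z t \<omega>)) \<in> M \<rightarrow>\<^sub>M borel" using assms(1,2) by (rule measurable_path_of)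
  have 2: "\<phi> \<in> borel_measurable borel"
    using path_lipschitz_continuous[OF \<phi>] by (rule borel_measurable_continuous_onI)
  show "integral\<^sup>L (path_law M Z) \<phi> = (\<integral>\<omega>. \<phi> (path_of (\<lambda>t. Z t \<omega>)) \<partial>M)"
    unfolding path_law_def by (rule integral_distr[OF 1 2])
  show "(\<lambda>\<omega>. \<phi> (path_of (\<lambda>t. Z t \<omega>))) \<in> borel_measurable M" using 1 2 by (rule measurable_compose)
qed

lemma prob_space_path_law:
  assumes "prob_space M" "\<And>t. t \<ge> 0 \<Longrightarrow> Z t \<in> borel_measurable M"
    "\<And>\<omega>. \<omega> \<in> space M \<Longrightarrow> continuous_on {0..} (\<lambda>t. Z t \<omega>)"
  shows "prob_space (path_law M Z)"
  unfolding path_law_def using assms by (intro prob_space.prob_space_distr measurable_path_of)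

lemma integrable_bounded_prob:
  fixes f :: "'a \<Rightarrow> real"
  assumes "prob_space M" "f \<in> borel_measurable M" "\<And>x. x \<in> space M \<Longrightarrow> \<bar>f x\<bar> \<le> C"
  shows "integrable M f"
proof -
  interpret prob_space M by fact
  show ?thesis by (rule integrable_const_bound[of _ C]) (use assms in auto)
qed

text \<open>A continuous functional is a pointwise limit of Lipschitz ones lying below it, which bounds the
  lower limit of its integrals from below. Applied to the functional and to its negative, this
  gives the limit.\<close>

lemma weakly_converges_lipschitzI:
  fixes \<mu> :: "'i \<Rightarrow> cpath measure"
  assumes \<mu>: "\<forall>\<^sub>F i in F. prob_space (\<mu> i) \<and> sets (\<mu> i) = sets borel"
    and \<nu>: "prob_space \<nu>" "sets \<nu> = sets borel"
    and lim: "\<And>k C \<psi>. path_lipschitz (real k) (real k) \<psi> \<Longrightarrow> (\<And>f. \<bar>\<psi> f\<bar> \<le> C) \<Longrightarrow>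
               ((\<lambda>i. integral\<^sup>L (\<mu> i) \<psi>) \<longlongrightarrow> integral\<^sup>L \<nu> \<psi>) F"
  shows "weakly_converges \<mu> \<nu> F"
proof -
  have lower: "\<forall>\<^sub>F i in F. a < integral\<^sup>L (\<mu> i) \<phi>"
    if \<phi>: "continuous_on UNIV \<phi>" "\<And>f. \<bar>\<phi> f\<bar> \<le> C" and a: "a < integral\<^sup>L \<nu> \<phi>" for \<phi> :: "cpath \<Rightarrow> real" and C a
  proof -
    have meas: "\<phi> \<in> borel_measurable borel" using \<phi>(1) by (rule borel_measurable_continuous_onI)
    have measl: "lipschitz_below k \<phi> \<in> borel_measurable borel" for k
      using path_lipschitz_continuous[OF path_lipschitz_lipschitz_below[OF \<phi>(2)]]
      by (intro borel_measurable_continuous_onI) simp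
    have "(\<lambda>k. lipschitz_below k \<phi> f) \<longlonglongrightarrow> \<phi> f" for f
    proof (rule lipschitz_below_tendsto[OF \<phi>(2)])
      fix a assume "a < \<phi> f"
      moreover have "open {g. a < \<phi> g}" by (rule open_Collect_less[OF continuous_on_const \<phi>(1)])
      ultimately show "\<exists>T e. e > 0 \<and> {g. \<forall>t\<in>{0..T}. \<bar>path_val g t - path_val f t\<bar> < e} \<subseteq> {g. a < \<phi> g}"
        unfolding open_cpath_def by blast
    qed
    then have "(\<lambda>k. integral\<^sup>L \<nu> (lipschitz_below k \<phi>)) \<longlonglongrightarrow> integral\<^sup>L \<nu> \<phi>"
      using \<nu> meas measl lipschitz_below_bound[OF \<phi>(2)]
      by (intro integral_dominated_convergence[where w="\<lambda>_. C"])
         (auto simp: prob_space.finite_measure finite_measure.integrable_const measurable_cong_sets[OF \<nu>(2) refl])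
    from order_tendstoD(1)[OF this a] obtain k where k: "a < integral\<^sup>L \<nu> (lipschitz_below k \<phi>)"
      by (auto simp: eventually_sequentially)
    from order_tendstoD(1)[OF lim[OF path_lipschitz_lipschitz_below[OF \<phi>(2)] lipschitz_below_bound[OF \<phi>(2)]] k] \<mu>
    show ?thesis
    proof eventually_elim
      case (elim i)
      have ms: "borel_measurable (\<mu> i) = borel_measurable (borel :: cpath measure)"
        using elim by (intro measurable_cong_sets) auto
      have "integral\<^sup>L (\<mu> i) (lipschitz_below k \<phi>) \<le> integral\<^sup>L (\<mu> i) \<phi>"
        using elim meas measl ms
        by (intro integral_mono integrable_bounded_prob[where C=C])
           (auto intro: \<phi>(2) lipschitz_below_bound[OF \<phi>(2)] lipschitz_below_le_self[OF \<phi>(2)])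
      then show ?case using elim by simp
    qed
  qed
  show ?thesis unfolding weakly_converges_def
  proof (intro allI impI)
    fix \<phi> :: "cpath \<Rightarrow> real" assume \<phi>: "continuous_on UNIV \<phi> \<and> bounded (range \<phi>)"
    then obtain C where C: "\<And>f. \<bar>\<phi> f\<bar> \<le> C" by (auto simp: bounded_iff)
    show "((\<lambda>i. integral\<^sup>L (\<mu> i) \<phi>) \<longlongrightarrow> integral\<^sup>L \<nu> \<phi>) F"
    proof (rule order_tendstoI)
      fix a assume "a < integral\<^sup>L \<nu> \<phi>"
      then show "\<forall>\<^sub>F i in F. a < integral\<^sup>L (\<mu> i) \<phi>" using lower \<phi> C by blast
    next
      fix a assume a: "integral\<^sup>L \<nu> \<phi> < a"
      have "\<forall>\<^sub>F i in F. - a < integral\<^sup>L (\<mu> i) (\<lambda>f. - \<phi> f)"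
        by (rule lower[where C=C]) (use \<phi> C a in \<open>auto intro: continuous_intros\<close>)
      then show "\<forall>\<^sub>F i in F. integral\<^sup>L (\<mu> i) \<phi> < a" by simp
    qed
  qed
qed

section \<open>The persistent chain as a finite tree of steps\<close>

text \<open>The current state \<open>y\<close> is not part of the list, so that consecutive stretches of the chain can be
  concatenated.\<close>

primrec steps :: "real \<Rightarrow> nat \<Rightarrow> int \<Rightarrow> int list pmf" where
  "steps p 0 y = return_pmf []"
| "steps p (Suc n) y = bind_pmf (bernoulli_pmf p)
     (\<lambda>b. let y' = (if b then y else - y) in map_pmf ((#) y') (steps p n y'))"

lemma set_pmf_steps:
  "l \<in> set_pmf (steps p n y) \<Longrightarrow> length l = n \<and> (y \<in> {-1, 1} \<longrightarrow> set l \<subseteq> {-1, 1})"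
  by (induction n arbitrary: y l) (fastforce simp: Let_def split: if_splits)+

lemma last_steps:
  assumes "l \<in> set_pmf (steps p n y)" "y \<in> {-1, 1}" shows "last (y # l) \<in> {-1, 1}"
proof -
  have "last (y # l) \<in> set (y # l)" by (rule last_in_set) simp
  moreover have "set (y # l) \<subseteq> {-1, 1}" using set_pmf_steps[OF assms(1)] assms(2) by auto
  ultimately show ?thesis by blast
qed

lemma finite_set_pmf_steps: "finite (set_pmf (steps p n y))"
  by (induction n arbitrary: y) (auto simp: Let_def)

text \<open>The Markov property: the past enters only through the last state, which is \<open>y\<close> itself if \<open>n = 0\<close>.\<close>

lemma steps_add:
  "steps p (n + m) y = bind_pmf (steps p n y) (\<lambda>l. map_pmf ((@) l) (steps p m (last (y # l))))"
proof (induction n arbitrary: y)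
  case (Suc n)
  show ?case
    by (simp add: Suc Let_def bind_assoc_pmf map_pmf_def bind_return_pmf)
next
  case 0
  have "(@) [] = (\<lambda>l :: int list. l)" by auto
  then show ?case by (simp add: bind_return_pmf)
qed

lemma expectation_bind_pmf_finite:
  fixes h :: "'b \<Rightarrow> 'c::{banach, second_countable_topology}"
  assumes "finite (set_pmf p)" "\<And>x. x \<in> set_pmf p \<Longrightarrow> finite (set_pmf (f x))"
  shows "measure_pmf.expectation (bind_pmf p f) h
     = measure_pmf.expectation p (\<lambda>x. measure_pmf.expectation (f x) h)"
  using assms by (simp add: pmf_expectation_bind[of "set_pmf p"] integral_measure_pmf[of "set_pmf p"])

lemma expectation_steps_add:
  fixes h :: "int list \<Rightarrow> 'c::{banach, second_countable_topology}"
  shows "measure_pmf.expectation (steps p (n + m) y) h = measure_pmf.expectation (steps p n y)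
     (\<lambda>l. measure_pmf.expectation (steps p m (last (y # l))) (\<lambda>l'. h (l @ l')))"
  unfolding steps_add by (subst expectation_bind_pmf_finite) (auto simp: finite_set_pmf_steps)

lemma expectation_steps_Suc:
  fixes h :: "int list \<Rightarrow> 'c::{banach, second_countable_topology}"
  assumes "0 \<le> p" "p \<le> 1"
  shows "measure_pmf.expectation (steps p (Suc n) y) h =
     p *\<^sub>R measure_pmf.expectation (steps p n y) (\<lambda>l. h (y # l)) +
     (1 - p) *\<^sub>R measure_pmf.expectation (steps p n (- y)) (\<lambda>l. h (- y # l))"
  unfolding steps.simps Let_def
  by (subst pmf_expectation_bind[of UNIV]) (use assms in \<open>auto simp: UNIV_bool finite_set_pmf_steps\<close>)

lemma pmf_steps_snoc:
  assumes "0 \<le> p" "p \<le> 1" "y \<in> {-1, 1}" "length l = n"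
  shows "pmf (steps p (Suc n) y) (l @ [j]) =
     pmf (steps p n y) l * (if j = last (y # l) then p else if j = - last (y # l) then 1 - p else 0)"
proof -
  have inj: "measure_pmf.prob (steps p 1 (last (y # l'))) {l''. l' @ l'' = l @ [j]} =
     (if l' = l then (if j = last (y # l) then p else if j = - last (y # l) then 1 - p else 0) else 0)"
    if l': "l' \<in> set_pmf (steps p n y)" for l'
  proof -
    have len: "length l' = length l" using set_pmf_steps[OF l'] assms by simp
    have last: "last (y # l') \<in> {-1, 1}" using last_steps[OF l' assms(3)] .
    have "measure_pmf.prob (steps p 1 (last (y # l'))) {l''. l' @ l'' = l @ [j]}
        = measure_pmf.expectation (steps p (Suc 0) (last (y # l'))) (indicator {l''. l' @ l'' = l @ [j]})"
      by simp
    also have "\<dots> = p * indicator {l''. l' @ l'' = l @ [j]} [last (y # l')]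
         + (1 - p) * indicator {l''. l' @ l'' = l @ [j]} [- last (y # l')]"
      using expectation_steps_Suc[OF assms(1,2), of 0 "last (y # l')" "indicator {l''. l' @ l'' = l @ [j]} :: _ \<Rightarrow> real"]
      by simp
    also have "\<dots> = (if l' = l then (if j = last (y # l) then p else if j = - last (y # l) then 1 - p else 0) else 0)"
    proof (cases "l' = l")
      case True
      define z where "z = last (y # l)"
      have "z = 1 \<or> z = -1" using last unfolding True z_def by auto
      then show ?thesis unfolding True z_def[symmetric] by (auto simp: indicator_def)
    qed (simp add: indicator_def)
    finally show ?thesis .
  qed
  have "pmf (steps p (Suc n) y) (l @ [j]) = measure_pmf.expectation (steps p (n + 1) y) (indicator {l @ [j]})"
    by (simp add: measure_pmf_single)
  also have "\<dots> = measure_pmf.expectation (steps p n y)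
     (\<lambda>l'. measure_pmf.prob (steps p 1 (last (y # l'))) {l''. l' @ l'' = l @ [j]})"
    unfolding expectation_steps_add
  proof (rule arg_cong2[where f="integral\<^sup>L", OF refl], rule ext)
    fix l'
    have "(\<lambda>l''. indicator {l @ [j]} (l' @ l'') :: real) = indicator {l''. l' @ l'' = l @ [j]}"
      by (auto simp: indicator_def fun_eq_iff)
    then show "measure_pmf.expectation (steps p 1 (last (y # l'))) (\<lambda>l''. indicator {l @ [j]} (l' @ l''))
       = measure_pmf.prob (steps p 1 (last (y # l'))) {l''. l' @ l'' = l @ [j]}"
      by simp
  qed
  also have "\<dots> = measure_pmf.expectation (steps p n y)
     (\<lambda>l'. (if j = last (y # l) then p else if j = - last (y # l) then 1 - p else 0) * indicator {l} l')"
    by (intro integral_cong_AE AE_pmfI) (simp_all only: inj, auto simp: indicator_def)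
  also have "\<dots> = pmf (steps p n y) l * (if j = last (y # l) then p else if j = - last (y # l) then 1 - p else 0)"
    by (simp add: measure_pmf_single)
  finally show ?thesis .
qed

text \<open>The initial state is left out, in accordance with \<open>steps\<close>.\<close>

definition trajectory :: "(nat \<Rightarrow> 'a \<Rightarrow> int) \<Rightarrow> nat \<Rightarrow> 'a \<Rightarrow> int list" where
  "trajectory Y n \<omega> = map (\<lambda>i. Y (Suc i) \<omega>) [0..<n]"

lemma measurable_to_count_space_UNIV: "f \<in> M \<rightarrow>\<^sub>M count_space S \<Longrightarrow> f \<in> M \<rightarrow>\<^sub>M count_space UNIV"
  by (erule measurable_compose[where g="\<lambda>x. x"]) simp

lemma measurable_trajectory:
  assumes "\<And>n. Y n \<in> M \<rightarrow>\<^sub>M count_space S"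
  shows "trajectory Y n \<in> M \<rightarrow>\<^sub>M count_space UNIV"
proof (induction n)
  case (Suc n)
  have Y: "Y (Suc n) \<in> M \<rightarrow>\<^sub>M count_space UNIV"
    by (rule measurable_to_count_space_UNIV[OF assms])
  have "(\<lambda>\<omega>. trajectory Y n \<omega> @ [Y (Suc n) \<omega>]) \<in> M \<rightarrow>\<^sub>M count_space UNIV"
    using Suc Y by measurable
  then show ?case by (simp add: trajectory_def)
qed (simp add: trajectory_def)

text \<open>Induction on \<open>n\<close>: the event that the trajectory extends a given list by one state is the event
  in the Markov property, up to the null set where the initial state is not \<open>y0\<close>. If the shorter
  list has probability zero, both sides vanish and the Markov property says nothing.\<close>

lemma distr_trajectory:
  assumes mc: "markov_chain M {-1, 1} (persistent_matrix c0 dx) Y"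
    and Y0: "AE \<omega> in M. Y 0 \<omega> = y0" and y0: "y0 \<in> {-1, 1}"
    and p: "p = - c0 * dx" "0 \<le> p" "p \<le> 1"
  shows "distr M (count_space UNIV) (trajectory Y n) = measure_pmf (steps p n y0)"
proof -
  interpret prob_space M using mc by (simp add: markov_chain_def)
  have Ym: "\<And>n. Y n \<in> M \<rightarrow>\<^sub>M count_space {-1, 1}" using mc by (simp add: markov_chain_def)
  have [measurable]: "\<And>n. Y n \<in> M \<rightarrow>\<^sub>M count_space UNIV"
    by (rule measurable_to_count_space_UNIV[OF Ym])
  note [measurable] = measurable_trajectory[OF Ym]
  have Yv: "Y i \<omega> \<in> {-1, 1}" if "\<omega> \<in> space M" for i \<omega>
    using measurable_space[OF Ym that] by simp
  have main: "\<P>(\<omega> in M. trajectory Y n \<omega> = l) = pmf (steps p n y0) l" for n l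
  proof (induction n arbitrary: l)
    case 0
    show ?case by (cases l) (simp_all add: trajectory_def pmf_return prob_space)
  next
    case (Suc n)
    show ?case
    proof (cases "length l = Suc n")
      case False
      then have "l \<notin> set_pmf (steps p (Suc n) y0)" using set_pmf_steps by blast
      moreover have "trajectory Y (Suc n) \<omega> \<noteq> l" for \<omega> using False by (auto simp: trajectory_def)
      ultimately show ?thesis by (simp add: set_pmf_iff del: steps.simps)
    next
      case True
      then obtain l0 j where l: "l = l0 @ [j]" "length l0 = n"
        by (metis length_Suc_conv_rev)
      have tr: "trajectory Y (Suc n) \<omega> = l \<longleftrightarrow> trajectory Y n \<omega> = l0 \<and> Y (Suc n) \<omega> = j" for \<omega>
        by (simp add: trajectory_def l)
      define y where "y i = (y0 # l0) ! i" for i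
      have last: "last (y0 # l0) = y n" using l(2) last_conv_nth[of "y0 # l0"] by (simp add: y_def del: last.simps)
      have ev: "trajectory Y n \<omega> = l0 \<longleftrightarrow> (\<forall>i\<le>n. Y i \<omega> = y i)" if "Y 0 \<omega> = y0" for \<omega>
      proof -
        have "trajectory Y n \<omega> = l0 \<longleftrightarrow> (\<forall>i<n. Y (Suc i) \<omega> = y (Suc i))"
          using l(2) by (auto simp: trajectory_def list_eq_iff_nth_eq y_def)
        also have "\<dots> \<longleftrightarrow> (\<forall>i\<le>n. Y i \<omega> = y i)"
          using that All_less_Suc2[of n "\<lambda>i. Y i \<omega> = y i"] by (simp add: less_Suc_eq_le y_def)
        finally show ?thesis .
      qed
      have [measurable]: "Measurable.pred M (\<lambda>\<omega>. \<forall>i\<le>n. Y i \<omega> = y i)" by measurable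
      have p0: "\<P>(\<omega> in M. \<forall>i\<le>n. Y i \<omega> = y i) = pmf (steps p n y0) l0"
        unfolding Suc.IH[symmetric]
      proof (rule prob_eq_AE)
        show "AE \<omega> in M. (\<forall>i\<le>n. Y i \<omega> = y i) \<longleftrightarrow> trajectory Y n \<omega> = l0"
          using Y0 by eventually_elim (simp add: ev)
      qed measurable
      have p1: "\<P>(\<omega> in M. trajectory Y (Suc n) \<omega> = l) = \<P>(\<omega> in M. Y (Suc n) \<omega> = j \<and> (\<forall>i\<le>n. Y i \<omega> = y i))"
        proof (rule prob_eq_AE)
        show "AE \<omega> in M. trajectory Y (Suc n) \<omega> = l \<longleftrightarrow> Y (Suc n) \<omega> = j \<and> (\<forall>i\<le>n. Y i \<omega> = y i)"
          using Y0 by eventually_elim (auto simp: ev tr)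
      qed measurable
      show ?thesis
      proof (cases "pmf (steps p n y0) l0 = 0")
        case True
        have "\<P>(\<omega> in M. Y (Suc n) \<omega> = j \<and> (\<forall>i\<le>n. Y i \<omega> = y i)) \<le> \<P>(\<omega> in M. \<forall>i\<le>n. Y i \<omega> = y i)"
          by (rule finite_measure_mono) auto
        then show ?thesis
          using True p0 p1 pmf_steps_snoc[OF p(2,3) y0 l(2)] measure_nonneg[of M] l
          by (simp add: order_antisym)
      next
        case False
        then have l0: "l0 \<in> set_pmf (steps p n y0)" by (simp add: set_pmf_iff)
        have yn: "y n \<in> {-1, 1}" unfolding last[symmetric] using last_steps[OF l0 y0] .
        show ?thesis
        proof (cases "j \<in> {-1, 1}")
          case True
          have pos: "\<P>(\<omega> in M. \<forall>i\<le>n. Y i \<omega> = y i) > 0" using False p0 by (simp add: order_less_le)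
          then have "\<P>(\<omega> in M. Y (Suc n) \<omega> = j \<bar> \<forall>i\<le>n. Y i \<omega> = y i) = persistent_matrix c0 dx (y n) j"
            using mc True unfolding markov_chain_def by blast
          then have "\<P>(\<omega> in M. Y (Suc n) \<omega> = j \<and> (\<forall>i\<le>n. Y i \<omega> = y i))
              = persistent_matrix c0 dx (y n) j * \<P>(\<omega> in M. \<forall>i\<le>n. Y i \<omega> = y i)"
            using pos by (simp add: cond_prob_def field_simps)
          also have "persistent_matrix c0 dx (y n) j = (if j = y n then p else if j = - y n then 1 - p else 0)"
            using True yn by (auto simp: persistent_matrix_def p(1))
          finally show ?thesis using p0 p1 pmf_steps_snoc[OF p(2,3) y0 l(2)] l last by simp
        next
          case False
          have "{\<omega> \<in> space M. trajectory Y (Suc n) \<omega> = l} = {}" using False Yv by (auto simp: tr)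
          then have "\<P>(\<omega> in M. trajectory Y (Suc n) \<omega> = l) = 0" by (simp only: measure_empty)
          moreover have "j \<noteq> y n" "j \<noteq> - y n" using False yn by auto
          ultimately show ?thesis
            using pmf_steps_snoc[OF p(2,3) y0 l(2), of j] last l(1) by (simp del: last.simps steps.simps)
        qed
      qed
    qed
  qed
  show ?thesis
  proof (rule measure_eqI_countable[of _ UNIV])
    fix l :: "int list"
    have "emeasure (distr M (count_space UNIV) (trajectory Y n)) {l} = emeasure M {\<omega> \<in> space M. trajectory Y n \<omega> = l}"
      by (subst emeasure_distr) (auto intro!: arg_cong2[where f=emeasure])
    also have "\<dots> = ennreal (pmf (steps p n y0) l)" by (simp add: emeasure_eq_measure main)
    finally show "emeasure (distr M (count_space UNIV) (trajectory Y n)) {l} = emeasure (measure_pmf (steps p n y0)) {l}"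
      by (simp add: emeasure_pmf_single)
  qed auto
qed

section \<open>The martingale part of the walk\<close>

text \<open>The number $\rho/(1-\rho) = \sum_{k \ge 1} \rho^k$ for $\rho = 2p - 1$: since the state after \<open>k\<close>
  steps has conditional expectation $\rho^k$ times the current one, the expected sum of all future
  states is this multiple of the current state.\<close>

definition correction :: "real \<Rightarrow> real" where
  "correction p = (2 * p - 1) / (2 - 2 * p)"

primrec mart :: "real \<Rightarrow> int \<Rightarrow> int list \<Rightarrow> real" where
  "mart p y [] = 0"
| "mart p y (y' # l) = of_int y' + correction p * of_int (y' - y) + mart p y' l"

lemma mart_eq: "mart p y l = of_int (sum_list l) + correction p * of_int (last (y # l) - y)"
  by (induction l arbitrary: y) (auto simp: algebra_simps)

text \<open>The correction is at most \<open>1/2\<close> in absolute value and two states differ by at most \<open>2\<close>.\<close>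

lemma mart_near_sum:
  assumes p: "0 \<le> p" "p \<le> 1/2" and "y \<in> {-1, 1}" "set l \<subseteq> {-1, 1}"
  shows "\<bar>mart p y l - of_int (sum_list l)\<bar> \<le> 1"
proof -
  have "last (y # l) \<in> set (y # l)" by (rule last_in_set) simp
  then have "last (y # l) \<in> {-1, 1}" using assms by auto
  then have "\<bar>last (y # l) - y\<bar> \<le> 2" using assms(3) by auto
  then have 1: "\<bar>real_of_int (last (y # l) - y)\<bar> \<le> 2" by linarith
  have 2: "\<bar>correction p\<bar> \<le> 1/2" using p by (simp add: correction_def abs_le_iff field_simps)
  have "\<bar>mart p y l - of_int (sum_list l)\<bar> = \<bar>correction p\<bar> * \<bar>real_of_int (last (y # l) - y)\<bar>"
    by (simp only: mart_eq abs_mult[symmetric] add_diff_cancel_left')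
  also have "\<dots> \<le> 1/2 * 2" using 1 2 by (intro mult_mono) auto
  finally show ?thesis by simp
qed

text \<open>This number is at the same time the size of a martingale increment after a flip and the
  conditional variance of an increment.\<close>

definition step_var :: "real \<Rightarrow> real" where "step_var p = p / (1 - p)"

lemma mart_stay: "mart p y (y # l) = of_int y + mart p y l"
  by simp

lemma mart_flip:
  assumes "p < 1" shows "mart p y (- y # l) = - of_int y * step_var p + mart p (- y) l"
  using assms by (simp add: correction_def step_var_def field_simps)

text \<open>The first four moments of an increment after the state \<open>1\<close>, which is \<open>1\<close> with probability \<open>p\<close>
  and \<open>- step_var p\<close> otherwise.\<close>

lemma increment_moments:
  assumes "0 \<le> p" "p < 1"
  shows "p - (1 - p) * step_var p = 0"
    "p + (1 - p) * step_var p ^ 2 = step_var p"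
    "p - (1 - p) * step_var p ^ 3 = step_var p * (1 - step_var p)"
    "p + (1 - p) * step_var p ^ 4 = step_var p * (1 - step_var p + step_var p ^ 2)"
proof -
  define q where "q = step_var p"
  have p: "p = q * (1 - p)" using assms by (simp add: q_def step_var_def)
  have q: "(1 - p) * (1 + q) = 1" using p by (simp add: algebra_simps)
  have "p - (1 - p) * q = 0" "p + (1 - p) * q ^ 2 = q * ((1 - p) * (1 + q))"
    "p - (1 - p) * q ^ 3 = q * (1 - q) * ((1 - p) * (1 + q))"
    "p + (1 - p) * q ^ 4 = q * (1 - q + q ^ 2) * ((1 - p) * (1 + q))"
    by (subst (1) p, simp add: algebra_simps power2_eq_square power3_eq_cube power4_eq_xxxx)+
  then show "p - (1 - p) * step_var p = 0"
    "p + (1 - p) * step_var p ^ 2 = step_var p"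
    "p - (1 - p) * step_var p ^ 3 = step_var p * (1 - step_var p)"
    "p + (1 - p) * step_var p ^ 4 = step_var p * (1 - step_var p + step_var p ^ 2)"
    unfolding q_def[symmetric] q by simp_all
qed

lemma step_var_bounds: "0 \<le> p \<Longrightarrow> p \<le> 1/2 \<Longrightarrow> 0 \<le> step_var p \<and> step_var p \<le> 1 \<and> p \<le> step_var p"
  by (auto simp: step_var_def field_simps)

subsection \<open>Characteristic function\<close>

text \<open>Second order Taylor expansion: the increment is centred with variance \<open>step_var p\<close> and bounded
  by \<open>1\<close>, so that its third absolute moment is again at most of the order of \<open>step_var p\<close>.\<close>

lemma increment_char:
  assumes p: "0 \<le> p" "p \<le> 1/2" and y: "y \<in> {-1, 1}"
  shows "cmod (p * iexp (u * of_int y) + (1 - p) * iexp (u * (- of_int y * step_var p)) - exp (- (u\<^sup>2 * step_var p / 2)))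
           \<le> \<bar>u\<bar> ^ 3 * step_var p + u ^ 4 * (step_var p)\<^sup>2"
proof -
  define q where "q = step_var p"
  note q = step_var_bounds[OF p, folded q_def]
  define R where "R x = iexp x - (1 + \<i> * x - x\<^sup>2 / 2)" for x :: real
  have R: "cmod (R x) \<le> \<bar>x\<bar> ^ 3 / 6" for x
    using iexp_approx1[of x 2] by (simp add: R_def numeral_eq_Suc algebra_simps)
  define E where "E = exp (- (u\<^sup>2 * q / 2)) - (1 - u\<^sup>2 * q / 2)"
  have E: "\<bar>E\<bar> \<le> u ^ 4 * q\<^sup>2"
  proof -
    define a where "a = u\<^sup>2 * q / 2"
    have a: "a \<ge> 0" using q by (simp add: a_def)
    have 1: "1 - a \<le> exp (- a)" using exp_ge_add_one_self[of "- a"] by simp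
    have "(1 - a + a\<^sup>2) * exp a \<ge> (1 - a + a\<^sup>2) * (1 + a)"
    proof (rule mult_left_mono)
      have "0 \<le> (a - 1/2)\<^sup>2 + 3/4" by simp
      then show "0 \<le> 1 - a + a\<^sup>2" by (simp add: power2_eq_square algebra_simps)
    qed (use exp_ge_add_one_self[of a] in simp)
    moreover have "(1 - a + a\<^sup>2) * (1 + a) = 1 + a ^ 3" by (simp add: algebra_simps power2_eq_square power3_eq_cube)
    ultimately have "1 \<le> (1 - a + a\<^sup>2) * exp a" using a by (smt (verit) zero_le_power)
    then have 2: "exp (- a) \<le> 1 - a + a\<^sup>2" by (simp add: exp_minus field_simps)
    have "\<bar>E\<bar> \<le> a\<^sup>2" using 1 2 unfolding E_def a_def by simp
    also have "\<dots> = u ^ 4 * q\<^sup>2 / 4" by (simp add: a_def power2_eq_square power4_eq_xxxx)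
    also have "\<dots> \<le> u ^ 4 * q\<^sup>2" by simp
    finally show ?thesis .
  qed
  have "p < 1" using p by simp
  note m = increment_moments[OF p(1) this, folded q_def]
  have yy: "(of_int y :: real)\<^sup>2 = 1" "\<bar>of_int y :: real\<bar> = 1" using y by auto
  have "p * iexp (u * of_int y) + (1 - p) * iexp (u * (- of_int y * q)) - exp (- (u\<^sup>2 * q / 2))
     = p * R (u * of_int y) + (1 - p) * R (u * (- of_int y * q)) - E
       + (\<i> * u * of_int y * of_real (p - (1 - p) * q) - u\<^sup>2 / 2 * ((of_int y)\<^sup>2 * of_real (p + (1 - p) * q\<^sup>2) - q))"
    by (simp add: R_def E_def field_simps power2_eq_square flip: exp_of_real)
  also have "\<dots> = p * R (u * of_int y) + (1 - p) * R (u * (- of_int y * q)) - E"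
    by (simp only: m(1,2) yy(1) of_real_0) simp
  also have "cmod \<dots> \<le> p * cmod (R (u * of_int y)) + (1 - p) * cmod (R (u * (- of_int y * q))) + \<bar>E\<bar>"
    using p by (intro norm_triangle_le_diff add_mono norm_triangle_le) (auto simp: norm_mult simp flip: of_real_diff)
  also have "\<dots> \<le> p * (\<bar>u\<bar> ^ 3 / 6) + (1 - p) * (\<bar>u\<bar> ^ 3 * q ^ 3 / 6) + u ^ 4 * q\<^sup>2"
    using p R[of "u * of_int y"] R[of "u * (- of_int y * q)"] E yy(2) q
    by (intro add_mono mult_left_mono) (auto simp: abs_mult power_mult_distrib)
  also have "\<dots> = \<bar>u\<bar> ^ 3 / 6 * (p + (1 - p) * q ^ 3) + u ^ 4 * q\<^sup>2" by (simp add: field_simps)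
  also have "\<dots> \<le> \<bar>u\<bar> ^ 3 / 6 * (6 * q) + u ^ 4 * q\<^sup>2"
  proof -
    have "q ^ 3 \<le> q" using q power_decreasing[of 1 3 q] by simp
    then have "(1 - p) * q ^ 3 \<le> 1 * q" using p q by (intro mult_mono) auto
    then have "p + (1 - p) * q ^ 3 \<le> 6 * q" using q by linarith
    then show ?thesis by (intro add_right_mono mult_left_mono) auto
  qed
  finally show ?thesis by (simp add: q_def)
qed

text \<open>One step multiplies the characteristic function by nearly the same factor for both states, since
  the conditional variance does not depend on the state. The one-step errors add up.\<close>

lemma mart_char:
  assumes p: "0 \<le> p" "p \<le> 1/2" and y: "y \<in> {-1, 1}"
  shows "cmod (measure_pmf.expectation (steps p n y) (\<lambda>l. iexp (u * mart p y l)) - exp (- (u\<^sup>2 * step_var p / 2)) ^ n)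
           \<le> real n * (\<bar>u\<bar> ^ 3 * step_var p + u ^ 4 * (step_var p)\<^sup>2)"
  using y
proof (induction n arbitrary: y)
  case (Suc n)
  define e where "e = \<bar>u\<bar> ^ 3 * step_var p + u ^ 4 * (step_var p)\<^sup>2"
  define g where "g = exp (- (u\<^sup>2 * step_var p / 2))"
  define ch where "ch y = measure_pmf.expectation (steps p n y) (\<lambda>l. iexp (u * mart p y l))" for y
  have g: "0 \<le> g" "g \<le> 1" using step_var_bounds[OF p] by (simp_all add: g_def)
  have IH: "cmod (ch y - of_real (g ^ n)) \<le> real n * e" "cmod (ch (- y) - of_real (g ^ n)) \<le> real n * e"
    using Suc.IH[of y] Suc.IH[of "- y"] Suc.prems by (auto simp: ch_def g_def e_def)
  define a b where "a = iexp (u * of_int y)" and "b = iexp (u * (- of_int y * step_var p))"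
  have ab: "cmod a = 1" "cmod b = 1" by (simp_all add: a_def b_def)
  have iexp_add: "iexp (u * (c + m)) = iexp (u * c) * iexp (u * m)" for c m
    by (simp add: distrib_left exp_add)
  have "iexp (u * mart p y (y # l)) = a * iexp (u * mart p y l)"
    "iexp (u * mart p y (- y # l)) = b * iexp (u * mart p (- y) l)" for l
    using p by (simp_all only: mart_stay mart_flip iexp_add a_def b_def)
  then have "measure_pmf.expectation (steps p (Suc n) y) (\<lambda>l. iexp (u * mart p y l))
     = p * (a * ch y) + (1 - p) * (b * ch (- y))"
    using p by (subst expectation_steps_Suc)
      (simp_all add: ch_def scaleR_conv_of_real del: mart.simps)
  then have "measure_pmf.expectation (steps p (Suc n) y) (\<lambda>l. iexp (u * mart p y l)) - of_real (g ^ Suc n)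
     = p * (a * (ch y - of_real (g ^ n))) + (1 - p) * (b * (ch (- y) - of_real (g ^ n)))
       + (p * a + (1 - p) * b - g) * of_real (g ^ n)"
    by (simp add: algebra_simps)
  also have "cmod \<dots> \<le> p * (real n * e) + (1 - p) * (real n * e) + e * 1"
  proof (intro norm_triangle_le add_mono)
    show "cmod (p * (a * (ch y - of_real (g ^ n)))) \<le> p * (real n * e)"
      using IH ab p by (auto simp: norm_mult intro!: mult_left_mono)
    have "cmod (complex_of_real (1 - p)) = 1 - p" using p by (subst norm_of_real) simp
    then show "cmod ((1 - p) * (b * (ch (- y) - of_real (g ^ n)))) \<le> (1 - p) * (real n * e)"
      unfolding norm_mult ab mult_1 using IH(2) p
      by (intro mult_mono) (auto intro: order_trans[OF norm_ge_zero IH(2)])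
    show "cmod ((p * a + (1 - p) * b - g) * of_real (g ^ n)) \<le> e * 1"
    proof -
      have 1: "cmod (p * a + (1 - p) * b - g) \<le> e"
        using increment_char[OF p Suc.prems, of u] by (simp only: a_def b_def g_def e_def of_real_diff of_real_1)
      have "cmod (of_real (g ^ n)) \<le> 1" using g by (simp only: norm_of_real abs_of_nonneg zero_le_power power_le_one)
      then show ?thesis unfolding norm_mult using 1
        by (intro mult_mono) (auto intro: order_trans[OF norm_ge_zero 1])
    qed
  qed
  also have "\<dots> = real (Suc n) * e" by (simp add: algebra_simps)
  finally show ?case by (simp only: e_def g_def of_real_power)
qed simp

subsection \<open>Maximal inequality\<close>

text \<open>A supermartingale when \<open>n\<close> counts the remaining steps and \<open>x\<close> is the current value of the
  martingale: the terms after \<open>x ^ 4\<close> compensate the growth of the fourth moment.\<close>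

definition quartic :: "real \<Rightarrow> nat \<Rightarrow> real \<Rightarrow> real" where
  "quartic q n x = x ^ 4 + 8 * real n * q * x\<^sup>2 + 8 * (real n * q)\<^sup>2 + 3 * real n * q"

text \<open>The third moment contributes \<open>4 * x * q * (1 - q)\<close> up to sign, which is absorbed by
  \<open>2 * q * (x\<^sup>2 + 1)\<close>; this is why the coefficient \<open>8\<close> exceeds the \<open>6\<close> of the second moment.\<close>

lemma quartic_step:
  assumes p: "0 \<le> p" "p \<le> 1/2" and y: "y \<in> {-1, 1 :: int}"
  shows "p * quartic (step_var p) n (x + of_int y) + (1 - p) * quartic (step_var p) n (x - of_int y * step_var p)
           \<le> quartic (step_var p) (Suc n) x"
proof -
  define q where "q = step_var p"
  define s :: real where "s = of_int y"
  have s: "s = 1 \<or> s = -1" using y by (auto simp: s_def)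
  note q = step_var_bounds[OF p, folded q_def]
  have "p < 1" using p by simp
  note m = increment_moments[OF p(1) this, folded q_def]
  have "p * quartic q n (x + s) + (1 - p) * quartic q n (x - s * q)
     = x ^ 4 + 4 * s * x ^ 3 * (p - (1 - p) * q) + 6 * x\<^sup>2 * (p + (1 - p) * q\<^sup>2) + 4 * s * x * (p - (1 - p) * q ^ 3)
       + (p + (1 - p) * q ^ 4) + 8 * real n * q * (x\<^sup>2 + 2 * s * x * (p - (1 - p) * q) + (p + (1 - p) * q\<^sup>2))
       + 8 * (real n * q)\<^sup>2 + 3 * real n * q"
    using s by (auto simp: quartic_def algebra_simps power2_eq_square power3_eq_cube power4_eq_xxxx)
  also have "\<dots> = x ^ 4 + 6 * x\<^sup>2 * q + 4 * s * x * (q * (1 - q)) + q * (1 - q + q\<^sup>2) + 8 * real n * q * (x\<^sup>2 + q)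
       + 8 * (real n * q)\<^sup>2 + 3 * real n * q"
    using p by (simp add: m)
  also have "\<dots> \<le> x ^ 4 + 6 * x\<^sup>2 * q + 2 * q * (x\<^sup>2 + 1) + q + 8 * real n * q * (x\<^sup>2 + q)
       + 8 * (real n * q)\<^sup>2 + 3 * real n * q"
  proof -
    have "2 * (s * x) \<le> x\<^sup>2 + 1" using s sum_squares_ge_zero[of "x - s" 0] by (auto simp: power2_eq_square algebra_simps)
    then have "2 * (s * x) * (1 - q) \<le> (x\<^sup>2 + 1) * 1"
      using q by (smt (verit) mult_left_le mult_nonneg_nonneg mult_right_mono zero_le_power2)
    then have "2 * q * (2 * (s * x) * (1 - q)) \<le> 2 * q * (x\<^sup>2 + 1)" using q by (intro mult_left_mono) auto
    moreover have "q * (1 - q + q\<^sup>2) \<le> q * 1"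
      using q power_decreasing[of 1 2 q] by (intro mult_left_mono) auto
    ultimately show ?thesis by (simp add: algebra_simps)
  qed
  also have "\<dots> \<le> quartic q (Suc n) x"
    using q by (simp add: quartic_def algebra_simps power2_eq_square)
  finally show ?thesis by (simp only: q_def s_def)
qed

text \<open>Doob's argument in the form of a first-step induction: either the threshold is already reached,
  and then the right-hand side is at least \<open>1\<close>, or one step is made and \<open>quartic_step\<close> applies.\<close>

lemma mart_maximal:
  assumes p: "0 \<le> p" "p \<le> 1/2" and y: "y \<in> {-1, 1}" and a: "a > 0"
  shows "measure_pmf.prob (steps p n y) {l. \<exists>j\<le>n. a \<le> \<bar>x + mart p y (take j l)\<bar>} \<le> quartic (step_var p) n x / a ^ 4"
  using y
proof (induction n arbitrary: x y)
  case 0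
  have "a ^ 4 \<le> x ^ 4" if "a \<le> \<bar>x\<bar>" using power_mono[OF that, of 4] a by simp
  then show ?case using a by (auto simp: quartic_def indicator_def field_simps)
next
  case (Suc n)
  note q = step_var_bounds[OF p]
  show ?case
  proof (cases "a \<le> \<bar>x\<bar>")
    case True
    have "a ^ 4 \<le> x ^ 4" using power_mono[OF True, of 4] a by simp
    also have "\<dots> \<le> quartic (step_var p) (Suc n) x" using q by (simp add: quartic_def)
    finally have "1 \<le> quartic (step_var p) (Suc n) x / a ^ 4" using a by simp
    then show ?thesis using measure_pmf.prob_le_1 order_trans by blast
  next
    case False
    let ?A = "\<lambda>n x y. {l. \<exists>j\<le>n. a \<le> \<bar>x + mart p y (take j l)\<bar>}"
    have ind: "y' # l \<in> ?A (Suc n) x y \<longleftrightarrow> l \<in> ?A n (x + d) y'"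
      if d: "\<And>l. mart p y (y' # l) = d + mart p y' l" for l y' d
    proof -
      have "y' # l \<in> ?A (Suc n) x y \<longleftrightarrow> (\<exists>j<Suc (Suc n). a \<le> \<bar>x + mart p y (take j (y' # l))\<bar>)"
        by (simp add: less_Suc_eq_le)
      also have "\<dots> \<longleftrightarrow> (\<exists>j<Suc n. a \<le> \<bar>x + mart p y (y' # take j l)\<bar>)"
        using False unfolding Ex_less_Suc2 by simp
      also have "\<dots> \<longleftrightarrow> l \<in> ?A n (x + d) y'" unfolding d by (simp add: less_Suc_eq_le add.assoc)
      finally show ?thesis .
    qed
    have "measure_pmf.prob (steps p (Suc n) y) (?A (Suc n) x y)
       = p * measure_pmf.expectation (steps p n y) (\<lambda>l. indicator (?A (Suc n) x y) (y # l))
       + (1 - p) * measure_pmf.expectation (steps p n (- y)) (\<lambda>l. indicator (?A (Suc n) x y) (- y # l))"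
      using expectation_steps_Suc[of p n y "indicator (?A (Suc n) x y) :: _ \<Rightarrow> real"] p by (simp del: steps.simps)
    also have "(\<lambda>l. indicator (?A (Suc n) x y) (y # l) :: real) = indicator (?A n (x + of_int y) y)"
      using ind[OF mart_stay] by (auto simp: fun_eq_iff indicator_def simp del: mem_Collect_eq)
    also have "(\<lambda>l. indicator (?A (Suc n) x y) (- y # l) :: real) = indicator (?A n (x + - of_int y * step_var p) (- y))"
      using ind[OF mart_flip] p by (auto simp: fun_eq_iff indicator_def simp del: mem_Collect_eq)
    also have "p * measure_pmf.expectation (steps p n y) (indicator (?A n (x + of_int y) y))
       + (1 - p) * measure_pmf.expectation (steps p n (- y)) (indicator (?A n (x + - of_int y * step_var p) (- y)))
     \<le> p * (quartic (step_var p) n (x + of_int y) / a ^ 4) + (1 - p) * (quartic (step_var p) n (x + - of_int y * step_var p) / a ^ 4)"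
      using p Suc.prems Suc.IH[of y "x + of_int y"] Suc.IH[of "- y" "x + - of_int y * step_var p"]
      by (intro add_mono mult_left_mono) auto
    also have "\<dots> = (p * quartic (step_var p) n (x + of_int y) + (1 - p) * quartic (step_var p) n (x - of_int y * step_var p)) / a ^ 4"
      by (simp add: add_divide_distrib)
    also have "\<dots> \<le> quartic (step_var p) (Suc n) x / a ^ 4"
      using quartic_step[OF p Suc.prems] a by (intro divide_right_mono) auto
    finally show ?thesis .
  qed
qed

text \<open>The threshold drops by \<open>1\<close> since the walk and its martingale part differ by at most \<open>1\<close>.\<close>

lemma walk_maximal:
  assumes p: "0 \<le> p" "p \<le> 1/2" and y: "y \<in> {-1, 1}" and a: "a > 1"
  shows "measure_pmf.prob (steps p n y) {l. \<exists>j\<le>n. a \<le> \<bar>real_of_int (sum_list (take j l))\<bar>}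
           \<le> (8 * (real n * step_var p)\<^sup>2 + 3 * real n * step_var p) / (a - 1) ^ 4"
proof -
  have "measure_pmf.prob (steps p n y) {l. \<exists>j\<le>n. a \<le> \<bar>real_of_int (sum_list (take j l))\<bar>}
     \<le> measure_pmf.prob (steps p n y) {l. \<exists>j\<le>n. a - 1 \<le> \<bar>0 + mart p y (take j l)\<bar>}"
  proof (rule measure_pmf.finite_measure_mono_AE[OF AE_pmfI])
    fix l assume l: "l \<in> set_pmf (steps p n y)"
    have "\<bar>mart p y (take j l) - of_int (sum_list (take j l))\<bar> \<le> 1" for j
      using set_pmf_steps[OF l] y by (intro mart_near_sum[OF p y]) (auto dest: in_set_takeD)
    then show "l \<in> {l. \<exists>j\<le>n. a \<le> \<bar>real_of_int (sum_list (take j l))\<bar>} \<longrightarrow>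
       l \<in> {l. \<exists>j\<le>n. a - 1 \<le> \<bar>0 + mart p y (take j l)\<bar>}"
      by (smt (verit) mem_Collect_eq)
  qed simp
  also have "\<dots> \<le> quartic (step_var p) n 0 / (a - 1) ^ 4" using a by (intro mart_maximal[OF p y]) simp
  finally show ?thesis by (simp add: quartic_def)
qed

section \<open>Gaussian limit of one block\<close>

text \<open>Defined as an image measure so that \<open>v = 0\<close> gives a point mass and needs no separate treatment.\<close>

definition gauss :: "real \<Rightarrow> real measure" where
  "gauss v = distr std_normal_distribution borel (\<lambda>x. sqrt v * x)"

lemma real_distribution_gauss: "real_distribution (gauss v)"
proof -
  interpret real_distribution std_normal_distribution by (rule real_dist_normal_dist)
  show ?thesis unfolding gauss_def by (rule real_distribution_distr) simp
qed

lemma prob_space_gauss: "prob_space (gauss v)"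
  using real_distribution_gauss by (simp add: real_distribution_def)

lemma sets_gauss [simp, measurable_cong]: "sets (gauss v) = sets borel"
  by (simp add: gauss_def)

lemma space_gauss [simp]: "space (gauss v) = UNIV"
  by (simp add: gauss_def)

lemma measure_gauss_UNIV [simp]: "measure (gauss v) UNIV = 1"
  using prob_space.prob_space[OF prob_space_gauss, of v] by simp

lemma char_gauss:
  assumes "0 \<le> v" shows "char (gauss v) t = exp (- (t\<^sup>2 * v / 2))"
proof -
  have "char (gauss v) t = char std_normal_distribution (t * sqrt v)"
    unfolding char_def gauss_def by (subst integral_distr) (auto simp: mult.assoc)
  also have "\<dots> = exp (- (t\<^sup>2 * v / 2))"
    using assms by (simp add: char_std_normal_distribution power_mult_distrib)
  finally show ?thesis .
qed

lemma iexp_lipschitz: "cmod (iexp a - iexp b) \<le> \<bar>a - b\<bar>"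
proof -
  have "iexp a - iexp b = iexp b * (iexp (a - b) - 1)"
    by (simp add: algebra_simps flip: exp_add)
  then have "cmod (iexp a - iexp b) = cmod (iexp (a - b) - 1)" by (simp add: norm_mult)
  also have "\<dots> \<le> \<bar>a - b\<bar>" using iexp_approx1[of "a - b" 0] by simp
  finally show ?thesis .
qed

lemma pmf_expectation_norm_le:
  fixes f :: "'x \<Rightarrow> 'c::{banach, second_countable_topology}"
  assumes "finite (set_pmf p)" "\<And>x. x \<in> set_pmf p \<Longrightarrow> norm (f x) \<le> c"
  shows "norm (measure_pmf.expectation p f) \<le> c"
proof -
  have "norm (measure_pmf.expectation p f) \<le> measure_pmf.expectation p (\<lambda>x. norm (f x))"
    by (rule integral_norm_bound)
  also have "\<dots> \<le> measure_pmf.expectation p (\<lambda>_. c)"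
    using assms by (intro integral_mono_AE integrable_measure_pmf_finite AE_pmfI) auto
  finally show ?thesis by simp
qed

lemma sum_char_near_mart:
  assumes p: "0 \<le> p" "p \<le> 1/2" and y: "y \<in> {-1, 1}"
  shows "cmod (measure_pmf.expectation (steps p n y) (\<lambda>l. iexp (u * of_int (sum_list l)))
           - measure_pmf.expectation (steps p n y) (\<lambda>l. iexp (u * mart p y l))) \<le> \<bar>u\<bar>"
proof -
  have fin: "integrable (measure_pmf (steps p n y)) f" for f :: "_ \<Rightarrow> complex"
    by (intro integrable_measure_pmf_finite finite_set_pmf_steps)
  have "cmod (iexp (u * of_int (sum_list l)) - iexp (u * mart p y l)) \<le> \<bar>u\<bar>"
    if l: "l \<in> set_pmf (steps p n y)" for l
  proof -
    have "cmod (iexp (u * of_int (sum_list l)) - iexp (u * mart p y l)) \<le> \<bar>u\<bar> * \<bar>mart p y l - of_int (sum_list l)\<bar>"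
      using iexp_lipschitz[of "u * of_int (sum_list l)" "u * mart p y l"]
      by (simp add: abs_minus_commute flip: abs_mult right_diff_distrib)
    also have "\<dots> \<le> \<bar>u\<bar> * 1"
      using set_pmf_steps[OF l] y by (intro mult_left_mono mart_near_sum[OF p y]) auto
    finally show ?thesis by simp
  qed
  then have "cmod (measure_pmf.expectation (steps p n y) (\<lambda>l. iexp (u * of_int (sum_list l)) - iexp (u * mart p y l)))
      \<le> \<bar>u\<bar>"
    by (intro pmf_expectation_norm_le finite_set_pmf_steps)
  then show ?thesis by (simp add: Bochner_Integration.integral_diff[OF fin fin])
qed

text \<open>With \<open>\<tau>\<close> the limit of $m \Delta_x^3$, the variance $m \Delta_x^2 \cdot p/(1-p)$ of the rescaled
  martingale tends to \<open>- c0 * \<tau>\<close>, and the accumulated error of \<open>mart_char\<close> is of the order of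
  $m \Delta_x^4$. Passing from the martingale to the walk costs at most \<open>\<bar>t * d i\<bar>\<close>.\<close>

lemma walk_clt:
  assumes c0: "c0 < 0" and d: "\<And>i. d i > 0" "d \<longlonglongrightarrow> 0"
    and m: "(\<lambda>i. real (m i) * d i ^ 3) \<longlonglongrightarrow> \<tau>" and y: "y \<in> {-1, 1}"
  shows "weak_conv_m (\<lambda>i. distr (measure_pmf (steps (- c0 * d i) (m i) y)) borel (\<lambda>l. d i * real_of_int (sum_list l)))
           (gauss (- c0 * \<tau>))"
proof (rule levy_continuity)
  show "real_distribution (distr (measure_pmf (steps (- c0 * d i) (m i) y)) borel (\<lambda>l. d i * real_of_int (sum_list l)))" for i
    by (rule prob_space.real_distribution_distr[OF measure_pmf.prob_space_axioms]) simp
  show "real_distribution (gauss (- c0 * \<tau>))" by (rule real_distribution_gauss)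
  fix t :: real
  define p where "p i = - c0 * d i" for i
  define w where "w i = - c0 / (1 - p i)" for i
  define A where "A i = measure_pmf.expectation (steps (p i) (m i) y) (\<lambda>l. iexp ((t * d i) * of_int (sum_list l)))" for i
  define B where "B i = measure_pmf.expectation (steps (p i) (m i) y) (\<lambda>l. iexp ((t * d i) * mart (p i) y l))" for i
  define G where "G i = complex_of_real (exp (- (t\<^sup>2 / 2 * (real (m i) * d i ^ 3) * w i)))" for i
  have tau: "0 \<le> \<tau>" using d(1) by (intro LIMSEQ_le_const[OF m] exI[of _ 0] allI impI mult_nonneg_nonneg) (auto intro: less_imp_le)
  have pl: "p \<longlonglongrightarrow> 0" using tendsto_mult[OF tendsto_const[of "- c0"] d(2)] by (simp add: p_def[abs_def])
  have wl: "w \<longlonglongrightarrow> - c0"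
    using tendsto_divide[OF tendsto_const[of "- c0"] tendsto_diff[OF tendsto_const[of 1] pl]] by (simp add: w_def[abs_def])
  have q: "step_var (p i) = d i * w i" for i by (simp add: step_var_def w_def p_def)
  have pev: "\<forall>\<^sub>F i in sequentially. 0 \<le> p i \<and> p i \<le> 1/2"
  proof -
    have "\<forall>\<^sub>F i in sequentially. p i < 1/2" using order_tendstoD(2)[OF pl, of "1/2"] by simp
    then show ?thesis
    proof eventually_elim
      case (elim i)
      then show ?case using c0 d(1)[of i] by (simp add: p_def mult_nonpos_nonneg)
    qed
  qed
  have "(\<lambda>i. A i - B i) \<longlonglongrightarrow> 0"
  proof (rule Lim_null_comparison)
    show "\<forall>\<^sub>F i in sequentially. norm (A i - B i) \<le> \<bar>t * d i\<bar>"
      using pev by eventually_elim (unfold A_def B_def, rule sum_char_near_mart, use y in auto)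
    show "(\<lambda>i. \<bar>t * d i\<bar>) \<longlonglongrightarrow> 0"
      using tendsto_mult[OF tendsto_const[of t] d(2)] by (intro tendsto_rabs_zero) simp
  qed
  moreover have "(\<lambda>i. B i - G i) \<longlonglongrightarrow> 0"
  proof (rule Lim_null_comparison)
    let ?e = "\<lambda>i. (real (m i) * d i ^ 3) * (\<bar>t\<bar> ^ 3 * d i * w i + t ^ 4 * d i ^ 3 * (w i)\<^sup>2)"
    show "\<forall>\<^sub>F i in sequentially. norm (B i - G i) \<le> ?e i"
      using pev
    proof eventually_elim
      case (elim i)
      have "G i = exp (- ((t * d i)\<^sup>2 * step_var (p i) / 2)) ^ m i"
        unfolding G_def exp_of_nat_mult[symmetric] of_real_power[symmetric] of_real_eq_iff q
        by (simp add: power2_eq_square power3_eq_cube algebra_simps)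
      then have "norm (B i - G i) \<le> real (m i) * (\<bar>t * d i\<bar> ^ 3 * step_var (p i) + (t * d i) ^ 4 * (step_var (p i))\<^sup>2)"
        using mart_char[of "p i" y "m i" "t * d i"] elim y unfolding B_def by simp
      also have "\<dots> = ?e i"
        using d(1)[of i] unfolding q
        by (simp add: abs_mult power_mult_distrib algebra_simps power2_eq_square power3_eq_cube power4_eq_xxxx)
      finally show ?case .
    qed
    have "?e \<longlonglongrightarrow> \<tau> * (\<bar>t\<bar> ^ 3 * 0 * (- c0) + t ^ 4 * 0 ^ 3 * (- c0)\<^sup>2)"
      by (intro tendsto_intros m d(2) wl)
    then show "?e \<longlonglongrightarrow> 0" by simp
  qed
  moreover have "G \<longlonglongrightarrow> complex_of_real (exp (- (t\<^sup>2 / 2 * \<tau> * (- c0))))"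
    unfolding G_def by (intro tendsto_intros m wl)
  ultimately have "(\<lambda>i. (A i - B i) + (B i - G i) + G i) \<longlonglongrightarrow> 0 + 0 + complex_of_real (exp (- (t\<^sup>2 / 2 * \<tau> * (- c0))))"
    by (intro tendsto_add)
  then have "A \<longlonglongrightarrow> complex_of_real (exp (- (t\<^sup>2 * (- c0 * \<tau>) / 2)))" by (simp add: ac_simps)
  moreover have "char (distr (measure_pmf (steps (- c0 * d i) (m i) y)) borel (\<lambda>l. d i * real_of_int (sum_list l))) t = A i" for i
    unfolding char_def A_def p_def by (subst integral_distr) (auto simp: mult.assoc)
  moreover have "0 \<le> - c0 * \<tau>" using c0 tau by (simp add: mult_nonpos_nonneg)
  ultimately show "(\<lambda>i. char (distr (measure_pmf (steps (- c0 * d i) (m i) y)) borel (\<lambda>l. d i * real_of_int (sum_list l))) t)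
      \<longlonglongrightarrow> char (gauss (- c0 * \<tau>)) t"
    by (simp only: char_gauss)
qed

text \<open>On a common probability space where the variables converge pointwise, two expectations of a test
  function differ by at most the expectation of the truncated distance \<open>min (2 * C) (L * \<bar>Z n - X\<bar>)\<close>,
  which no longer involves the test function.\<close>

lemma weak_conv_uniform_lipschitz:
  fixes C L :: real
  assumes \<mu>: "\<And>n. real_distribution (\<mu> n)" and M: "real_distribution M" and conv: "weak_conv_m \<mu> M"
    and C: "C \<ge> 0" and L: "L \<ge> 0"
  obtains e where "e \<longlonglongrightarrow> 0"
    "\<And>n g. (\<And>x y. \<bar>g x - g y\<bar> \<le> L * \<bar>x - y\<bar>) \<Longrightarrow> (\<And>x. \<bar>g x\<bar> \<le> C) \<Longrightarrow>
       \<bar>integral\<^sup>L (\<mu> n) g - integral\<^sup>L M g\<bar> \<le> e n"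
proof -
  obtain \<Omega> :: "real measure" and Z X where \<Omega>: "prob_space \<Omega>"
    and Z': "\<forall>n. Z n \<in> borel_measurable \<Omega>" "\<forall>n. distr \<Omega> borel (Z n) = \<mu> n"
    and X': "X \<in> measurable \<Omega> lborel" "distr \<Omega> borel X = M"
    and lim': "\<forall>x\<in>space \<Omega>. (\<lambda>n. Z n x) \<longlonglongrightarrow> X x"
    using Skorohod[OF \<mu> M conv] by blast
  have Z: "Z n \<in> borel_measurable \<Omega>" "distr \<Omega> borel (Z n) = \<mu> n" for n using Z' by auto
  have X: "X \<in> borel_measurable \<Omega>" "distr \<Omega> borel X = M" using X' by simp_all
  have lim: "(\<lambda>n. Z n x) \<longlonglongrightarrow> X x" if "x \<in> space \<Omega>" for x using lim' that by blast
  interpret \<Omega>: prob_space \<Omega> by fact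
  note [measurable] = Z(1) X(1)
  define e where "e n = (\<integral>x. min (2 * C) (L * \<bar>Z n x - X x\<bar>) \<partial>\<Omega>)" for n
  have min_int: "integrable \<Omega> (\<lambda>x. min (2 * C) (L * \<bar>Z n x - X x\<bar>))" for n
    using C L by (intro integrable_bounded_prob[OF \<Omega>, where C="2 * C"]) (auto simp: min_def)
  show thesis
  proof
    have "(\<lambda>n. \<integral>x. min (2 * C) (L * \<bar>Z n x - X x\<bar>) \<partial>\<Omega>) \<longlonglongrightarrow> (\<integral>x. 0 \<partial>\<Omega>)"
    proof (rule integral_dominated_convergence[where w="\<lambda>_. 2 * C"])
      show "AE x in \<Omega>. (\<lambda>n. min (2 * C) (L * \<bar>Z n x - X x\<bar>)) \<longlonglongrightarrow> 0"
      proof (rule AE_I2)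
        fix x assume "x \<in> space \<Omega>"
        then have "(\<lambda>n. min (2 * C) (L * \<bar>Z n x - X x\<bar>)) \<longlonglongrightarrow> min (2 * C) (L * \<bar>X x - X x\<bar>)"
          by (intro tendsto_intros lim)
        then show "(\<lambda>n. min (2 * C) (L * \<bar>Z n x - X x\<bar>)) \<longlonglongrightarrow> 0" using C by simp
      qed
    qed (use C L in \<open>auto simp: min_def\<close>)
    then show "e \<longlonglongrightarrow> 0" by (simp add: e_def[abs_def])
  next
    fix n g assume g: "\<And>x y. \<bar>g x - g y\<bar> \<le> L * \<bar>x - y\<bar>" "\<And>x. \<bar>g x\<bar> \<le> C"
    have "L-lipschitz_on UNIV g" using g(1) L by (intro lipschitz_onI) (auto simp: dist_real_def)
    then have [measurable]: "g \<in> borel_measurable borel"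
      by (intro borel_measurable_continuous_onI lipschitz_on_continuous_on)
    have "integrable \<Omega> (\<lambda>x. g (Z n x))" by (rule integrable_bounded_prob[OF \<Omega>, where C=C]) (simp_all add: g(2))
    moreover have "integrable \<Omega> (\<lambda>x. g (X x))" by (rule integrable_bounded_prob[OF \<Omega>, where C=C]) (simp_all add: g(2))
    ultimately have int: "integrable \<Omega> (\<lambda>x. g (Z n x))" "integrable \<Omega> (\<lambda>x. g (X x))" .
    have "\<bar>integral\<^sup>L (\<mu> n) g - integral\<^sup>L M g\<bar> = \<bar>\<integral>x. g (Z n x) - g (X x) \<partial>\<Omega>\<bar>"
      unfolding Z(2)[symmetric] X(2)[symmetric] by (simp add: integral_distr int)
    also have "\<dots> \<le> e n"
    proof -
      have "\<bar>g (Z n x) - g (X x)\<bar> \<le> min (2 * C) (L * \<bar>Z n x - X x\<bar>)" for x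
        using g(1)[of "Z n x" "X x"] g(2)[of "Z n x"] g(2)[of "X x"] by simp
      then show ?thesis unfolding e_def
        by (intro integral_abs_bound_integral Bochner_Integration.integrable_diff int min_int)
    qed
    finally show "\<bar>integral\<^sup>L (\<mu> n) g - integral\<^sup>L M g\<bar> \<le> e n" .
  qed
qed

section \<open>Joint limit of the block increments\<close>

definition incr :: "real \<Rightarrow> (nat \<Rightarrow> nat) \<Rightarrow> int list \<Rightarrow> nat \<Rightarrow> real" where
  "incr d N l k = d * real_of_int (sum_list (take (N (Suc k)) l) - sum_list (take (N k) l))"

text \<open>Induction on the number of blocks. Given the past, the last increment may be replaced by a
  Gaussian one, with an error that is uniform in the past by \<open>weak_conv_uniform_lipschitz\<close>;
  integrating it out leaves a bounded Lipschitz function of the earlier increments.\<close>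

lemma block_increments_limit:
  fixes h :: "(nat \<Rightarrow> real) \<Rightarrow> real"
  assumes c0: "c0 < 0" and d: "\<And>i. d i > 0" "d \<longlonglongrightarrow> 0" and y0: "y0 \<in> {-1, 1}"
    and N: "\<And>i. N i 0 = 0" "\<And>i. mono (N i)"
    and Nl: "\<And>k. (\<lambda>i. real (N i (Suc k) - N i k) * d i ^ 3) \<longlonglongrightarrow> \<tau>"
    and h: "h \<in> borel_measurable (PiM {..<K} (\<lambda>_. borel))" "\<And>x. \<bar>h x\<bar> \<le> C"
      "\<And>x k z. k < K \<Longrightarrow> \<bar>h (x(k := z)) - h x\<bar> \<le> L * \<bar>z - x k\<bar>" and C: "C \<ge> 0" and L: "L \<ge> 0"
  shows "(\<lambda>i. measure_pmf.expectation (steps (- c0 * d i) (N i K) y0) (\<lambda>l. h (restrict (incr (d i) (N i) l) {..<K})))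
           \<longlonglongrightarrow> (\<integral>x. h x \<partial>PiM {..<K} (\<lambda>_. gauss (- c0 * \<tau>)))"
  using h
proof (induction K arbitrary: h)
  case 0
  have "(\<integral>x. h x \<partial>PiM {..<0} (\<lambda>_. gauss (- c0 * \<tau>))) = h (\<lambda>_. undefined)"
    by (simp add: PiM_empty lebesgue_integral_count_space_finite)
  then show ?case by (simp add: N)
next
  case (Suc K)
  interpret G: prob_space "gauss (- c0 * \<tau>)" by (rule prob_space_gauss)
  interpret PG: product_prob_space "\<lambda>_ :: nat. gauss (- c0 * \<tau>)" by standard
  have setsPi: "sets (PiM I (\<lambda>_. gauss (- c0 * \<tau>))) = sets (PiM I (\<lambda>_. borel :: real measure))" for I :: "nat set"
    by (intro sets_PiM_cong) auto
  let ?y = "{-1, 1 :: int}"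
  define h' where "h' x = (\<integral>g. h (x(K := g)) \<partial>gauss (- c0 * \<tau>))" for x
  have lipK: "\<bar>h (x(K := a)) - h (x(K := b))\<bar> \<le> L * \<bar>a - b\<bar>" for x a b
    using Suc.prems(3)[of K "x(K := b)" a] by (simp only: fun_upd_upd fun_upd_same lessI simp_thms)
  have meas1: "(\<lambda>g. h (x(K := g))) \<in> borel_measurable borel" for x
  proof -
    have "L-lipschitz_on UNIV (\<lambda>g. h (x(K := g)))" using lipK L by (intro lipschitz_onI) (auto simp: dist_real_def)
    then show ?thesis by (intro borel_measurable_continuous_onI lipschitz_on_continuous_on)
  qed
  have int1: "integrable (gauss (- c0 * \<tau>)) (\<lambda>g. h (x(K := g)))" for x
    using meas1 Suc.prems(2) by (intro integrable_bounded_prob[OF prob_space_gauss, where C=C]) (simp_all add: measurable_cong_sets[OF sets_gauss refl])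
  have ins: "{..<Suc K} = insert K {..<K}" by auto
  have lim: "(\<lambda>i. measure_pmf.expectation (steps (- c0 * d i) (N i K) y0) (\<lambda>l. h' (restrict (incr (d i) (N i) l) {..<K})))
           \<longlonglongrightarrow> (\<integral>x. h' x \<partial>PiM {..<K} (\<lambda>_. gauss (- c0 * \<tau>)))"
  proof (rule Suc.IH)
    have "(\<lambda>(x, g). h (x(K := g))) \<in> borel_measurable (PiM {..<K} (\<lambda>_. borel) \<Otimes>\<^sub>M borel)"
      using measurable_compose[OF measurable_add_dim[of K "{..<K}" "\<lambda>_. borel"] Suc.prems(1)[unfolded ins]]
      by (simp only: case_prod_beta')
    then have "(\<lambda>(x, g). h (x(K := g))) \<in> borel_measurable (PiM {..<K} (\<lambda>_. borel) \<Otimes>\<^sub>M gauss (- c0 * \<tau>))"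
      by (subst measurable_cong_sets[OF sets_pair_measure_cong[OF refl sets_gauss] refl])
    then show "h' \<in> borel_measurable (PiM {..<K} (\<lambda>_. borel))"
      unfolding h'_def by (rule G.borel_measurable_lebesgue_integral)
    show "\<bar>h' x\<bar> \<le> C" for x
    proof -
      have "\<bar>h' x\<bar> \<le> (\<integral>g. C \<partial>gauss (- c0 * \<tau>))"
        unfolding h'_def by (intro integral_abs_bound_integral int1 Suc.prems(2) G.integrable_const)
      then show ?thesis by simp
    qed
    show "\<bar>h' (x(k := z)) - h' x\<bar> \<le> L * \<bar>z - x k\<bar>" if k: "k < K" for x k z
    proof -
      have "\<bar>h (x(k := z, K := g)) - h (x(K := g))\<bar> \<le> L * \<bar>z - x k\<bar>" for g
      proof -
        have tw: "x(k := z, K := g) = x(K := g, k := z)" using k by (intro fun_upd_twist) simp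
        have kk: "(x(K := g)) k = x k" using k by simp
        show ?thesis using Suc.prems(3)[of k "x(K := g)" z] k unfolding tw kk by (simp only: less_SucI simp_thms)
      qed
      then have "\<bar>\<integral>g. h (x(k := z, K := g)) - h (x(K := g)) \<partial>gauss (- c0 * \<tau>)\<bar> \<le> (\<integral>g. L * \<bar>z - x k\<bar> \<partial>gauss (- c0 * \<tau>))"
        by (intro integral_abs_bound_integral Bochner_Integration.integrable_diff int1 G.integrable_const)
      then show ?thesis unfolding h'_def Bochner_Integration.integral_diff[OF int1 int1] by simp
    qed
  qed
  have "\<exists>e. e \<longlonglongrightarrow> 0 \<and> (\<forall>i g. (\<forall>x y. \<bar>g x - g y\<bar> \<le> L * \<bar>x - y\<bar>) \<longrightarrow> (\<forall>x. \<bar>g x\<bar> \<le> C) \<longrightarrow>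
     \<bar>measure_pmf.expectation (steps (- c0 * d i) (N i (Suc K) - N i K) y) (\<lambda>l. g (d i * real_of_int (sum_list l)))
        - integral\<^sup>L (gauss (- c0 * \<tau>)) g\<bar> \<le> e i)" if y: "y \<in> ?y" for y
  proof -
    define \<mu> where "\<mu> i = distr (measure_pmf (steps (- c0 * d i) (N i (Suc K) - N i K) y)) borel (\<lambda>l. d i * real_of_int (sum_list l))" for i
    have rd: "real_distribution (\<mu> i)" for i
      unfolding \<mu>_def by (rule prob_space.real_distribution_distr[OF measure_pmf.prob_space_axioms]) simp
    have "weak_conv_m \<mu> (gauss (- c0 * \<tau>))"
      unfolding \<mu>_def using walk_clt[OF c0 d Nl[of K] y] .
    from weak_conv_uniform_lipschitz[OF rd real_distribution_gauss this C L] obtain e where e: "e \<longlonglongrightarrow> 0"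
      "\<And>n g. (\<And>x y. \<bar>g x - g y\<bar> \<le> L * \<bar>x - y\<bar>) \<Longrightarrow> (\<And>x. \<bar>g x\<bar> \<le> C) \<Longrightarrow>
       \<bar>integral\<^sup>L (\<mu> n) g - integral\<^sup>L (gauss (- c0 * \<tau>)) g\<bar> \<le> e n" by blast
    show ?thesis
    proof (intro exI[of _ e] conjI allI impI)
      fix i g assume g: "\<forall>x y. \<bar>g x - g y\<bar> \<le> L * \<bar>x - y\<bar>" "\<forall>x. \<bar>g x\<bar> \<le> C"
      have "L-lipschitz_on UNIV g" using g(1) L by (intro lipschitz_onI) (auto simp: dist_real_def)
      then have "g \<in> borel_measurable borel" by (intro borel_measurable_continuous_onI lipschitz_on_continuous_on)
      then have "integral\<^sup>L (\<mu> i) g = measure_pmf.expectation (steps (- c0 * d i) (N i (Suc K) - N i K) y) (\<lambda>l. g (d i * real_of_int (sum_list l)))"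
        unfolding \<mu>_def by (subst integral_distr) auto
      then show "\<bar>measure_pmf.expectation (steps (- c0 * d i) (N i (Suc K) - N i K) y) (\<lambda>l. g (d i * real_of_int (sum_list l)))
        - integral\<^sup>L (gauss (- c0 * \<tau>)) g\<bar> \<le> e i"
        using e(2)[of g i] g by simp
    qed (rule e(1))
  qed
  then obtain e where e: "\<And>y. y \<in> ?y \<Longrightarrow> e y \<longlonglongrightarrow> 0"
    "\<And>y i g. y \<in> ?y \<Longrightarrow> \<forall>x y. \<bar>g x - g y\<bar> \<le> L * \<bar>x - y\<bar> \<Longrightarrow> \<forall>x. \<bar>g x\<bar> \<le> C \<Longrightarrow>
     \<bar>measure_pmf.expectation (steps (- c0 * d i) (N i (Suc K) - N i K) y) (\<lambda>l. g (d i * real_of_int (sum_list l)))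
        - integral\<^sup>L (gauss (- c0 * \<tau>)) g\<bar> \<le> e y i"
    by metis
  \<comment> \<open>The last block starts in one of two states; the sum bounds the error for both.\<close>
  define E where "E i = \<bar>e 1 i\<bar> + \<bar>e (-1) i\<bar>" for i
  have E: "E \<longlonglongrightarrow> 0"
    using tendsto_add[OF tendsto_rabs_zero[OF e(1)[of 1]] tendsto_rabs_zero[OF e(1)[of "-1"]]] by (simp add: E_def[abs_def])
  let ?A = "\<lambda>i. measure_pmf.expectation (steps (- c0 * d i) (N i (Suc K)) y0) (\<lambda>l. h (restrict (incr (d i) (N i) l) {..<Suc K}))"
  let ?B = "\<lambda>i. measure_pmf.expectation (steps (- c0 * d i) (N i K) y0) (\<lambda>l. h' (restrict (incr (d i) (N i) l) {..<K}))"
  have AB: "\<bar>?A i - ?B i\<bar> \<le> E i" for i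
  proof -
    define m where "m = N i (Suc K) - N i K"
    have m: "N i (Suc K) = N i K + m" using N(2)[of i] by (simp add: m_def mono_def)
    let ?S = "steps (- c0 * d i)"
    have fin: "integrable (measure_pmf (?S n y)) f" for f :: "int list \<Rightarrow> real" and n y
      by (intro integrable_measure_pmf_finite finite_set_pmf_steps)
    have split: "restrict (incr (d i) (N i) (l @ l')) {..<Suc K} = (restrict (incr (d i) (N i) l) {..<K})(K := d i * real_of_int (sum_list l'))"
      if l: "length l = N i K" "length l' = m" for l l'
    proof -
      have "incr (d i) (N i) (l @ l') k = incr (d i) (N i) l k" if "k < K" for k
      proof -
        have "N i (Suc k) \<le> N i K" "N i k \<le> N i K" using N(2)[of i] that by (auto simp: mono_def)
        then show ?thesis by (simp add: incr_def l)
      qed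
      moreover have "incr (d i) (N i) (l @ l') K = d i * real_of_int (sum_list l')"
        by (simp add: incr_def l m)
      ultimately show ?thesis by (auto simp: fun_eq_iff restrict_def)
    qed
    have "?A i = measure_pmf.expectation (?S (N i K) y0) (\<lambda>l. measure_pmf.expectation (?S m (last (y0 # l)))
        (\<lambda>l'. h (restrict (incr (d i) (N i) (l @ l')) {..<Suc K})))"
      unfolding m by (rule expectation_steps_add)
    then have "\<bar>?A i - ?B i\<bar> = \<bar>measure_pmf.expectation (?S (N i K) y0) (\<lambda>l. measure_pmf.expectation (?S m (last (y0 # l)))
        (\<lambda>l'. h (restrict (incr (d i) (N i) (l @ l')) {..<Suc K})) - h' (restrict (incr (d i) (N i) l) {..<K}))\<bar>"
      by (simp only: Bochner_Integration.integral_diff[OF fin fin])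
    also have "\<dots> \<le> E i"
      unfolding real_norm_def[symmetric]
    proof (intro pmf_expectation_norm_le finite_set_pmf_steps)
      fix l assume l: "l \<in> set_pmf (?S (N i K) y0)"
      let ?x = "restrict (incr (d i) (N i) l) {..<K}" and ?z = "last (y0 # l)"
      have z: "?z \<in> ?y" by (rule last_steps[OF l y0])
      have len: "length l = N i K" using set_pmf_steps[OF l] by simp
      have "measure_pmf.expectation (?S m ?z) (\<lambda>l'. h (restrict (incr (d i) (N i) (l @ l')) {..<Suc K}))
          = measure_pmf.expectation (?S m ?z) (\<lambda>l'. h (?x(K := d i * real_of_int (sum_list l'))))"
        by (intro integral_cong_AE AE_pmfI) (simp_all add: split[OF len set_pmf_steps[THEN conjunct1]])
      moreover have "\<bar>measure_pmf.expectation (?S m ?z) (\<lambda>l'. h (?x(K := d i * real_of_int (sum_list l')))) - h' ?x\<bar> \<le> e ?z i"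
        unfolding m_def h'_def
        by (rule e(2)[OF z, of "\<lambda>g. h (?x(K := g))" i]) (use lipK Suc.prems(2) in blast)+
      moreover have "e ?z i \<le> E i" using z by (auto simp: E_def simp del: last.simps)
      ultimately show "norm (measure_pmf.expectation (?S m (last (y0 # l)))
        (\<lambda>l'. h (restrict (incr (d i) (N i) (l @ l')) {..<Suc K})) - h' (restrict (incr (d i) (N i) l) {..<K})) \<le> E i"
        by (simp only: real_norm_def)
    qed
    finally show ?thesis .
  qed
  have "(\<lambda>i. ?A i - ?B i) \<longlonglongrightarrow> 0"
    by (rule Lim_null_comparison[OF _ E]) (intro always_eventually allI, simp only: real_norm_def AB)
  from tendsto_add[OF this lim]
  have "?A \<longlonglongrightarrow> (\<integral>x. h' x \<partial>PiM {..<K} (\<lambda>_. gauss (- c0 * \<tau>)))" by simp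
  also have "(\<integral>x. h' x \<partial>PiM {..<K} (\<lambda>_. gauss (- c0 * \<tau>))) = (\<integral>x. h x \<partial>PiM {..<Suc K} (\<lambda>_. gauss (- c0 * \<tau>)))"
    unfolding ins h'_def
  proof (rule PG.product_integral_insert[symmetric])
    show "integrable (PiM (insert K {..<K}) (\<lambda>_. gauss (- c0 * \<tau>))) h"
      using Suc.prems(1,2) unfolding ins
      by (intro integrable_bounded_prob[where C=C] prob_space_PiM prob_space_gauss)
         (simp_all add: measurable_cong_sets[OF setsPi refl])
  qed auto
  finally show ?case .
qed

section \<open>Brownian increments\<close>

lemma brownian_increment_distr:
  assumes W: "standard_brownian_motion N W" and v: "v > 0" and st: "0 \<le> s" "s < t"
  shows "distr N borel (\<lambda>\<omega>. sqrt v * (W t \<omega> - W s \<omega>)) = gauss (v * (t - s))"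
proof -
  interpret prob_space N using W by (simp add: standard_brownian_motion_def)
  have pos: "0 < sqrt (t - s)" using st by simp
  have "distributed N lborel (\<lambda>\<omega>. W t \<omega> - W s \<omega>) (normal_density 0 (sqrt (t - s)))"
    using W st unfolding standard_brownian_motion_def by blast
  then have D: "distributed N lborel (\<lambda>\<omega>. (W t \<omega> - W s \<omega> - 0) / sqrt (t - s)) std_normal_density"
    unfolding normal_standard_normal_convert[OF pos] .
  have m: "(\<lambda>\<omega>. (W t \<omega> - W s \<omega> - 0) / sqrt (t - s)) \<in> N \<rightarrow>\<^sub>M lborel"
    using distributed_measurable[OF D] .
  have "gauss (v * (t - s)) = distr (distr N lborel (\<lambda>\<omega>. (W t \<omega> - W s \<omega> - 0) / sqrt (t - s))) borel (\<lambda>x. sqrt (v * (t - s)) * x)"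
    unfolding gauss_def distributed_distr_eq_density[OF D, symmetric] by simp
  also have "\<dots> = distr N borel ((\<lambda>x. sqrt (v * (t - s)) * x) \<circ> (\<lambda>\<omega>. (W t \<omega> - W s \<omega> - 0) / sqrt (t - s)))"
    by (rule distr_distr[OF _ m]) simp
  also have "(\<lambda>x. sqrt (v * (t - s)) * x) \<circ> (\<lambda>\<omega>. (W t \<omega> - W s \<omega> - 0) / sqrt (t - s)) = (\<lambda>\<omega>. sqrt v * (W t \<omega> - W s \<omega>))"
    using pos by (simp add: fun_eq_iff real_sqrt_mult)
  finally show ?thesis ..
qed

lemma brownian_increments_integral:
  fixes h :: "(nat \<Rightarrow> real) \<Rightarrow> real"
  assumes W: "standard_brownian_motion N W" and v: "v > 0" and s: "s > 0" and K: "K > 0"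
    and h: "h \<in> borel_measurable (PiM {..<K} (\<lambda>_. borel))"
  shows "(\<integral>\<omega>. h (\<lambda>k\<in>{..<K}. sqrt v * (W (real (Suc k) * s) \<omega> - W (real k * s) \<omega>)) \<partial>N)
           = (\<integral>x. h x \<partial>PiM {..<K} (\<lambda>_ :: nat. gauss (v * s)))"
proof -
  interpret prob_space N using W by (simp add: standard_brownian_motion_def)
  let ?X = "\<lambda>k \<omega>. sqrt v * (W (real (Suc k) * s) \<omega> - W (real k * s) \<omega>)"
  have Wm: "W t \<in> borel_measurable N" if "t \<ge> 0" for t
    using W that by (simp add: standard_brownian_motion_def)
  have Xm: "random_variable borel (?X k)" for k
    using s by (intro borel_measurable_times borel_measurable_diff Wm borel_measurable_const) auto
  have "indep_vars (\<lambda>_. borel) (\<lambda>k \<omega>. W (real (Suc k) * s) \<omega> - W (real k * s) \<omega>) {..<K}"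
  proof -
    have inc: "\<forall>n (t :: nat \<Rightarrow> real). 0 \<le> t 0 \<and> (\<forall>i<n. t i \<le> t (Suc i)) \<longrightarrow>
        indep_vars (\<lambda>_. borel) (\<lambda>i \<omega>. W (t (Suc i)) \<omega> - W (t i) \<omega>) {..<n}"
      using W unfolding standard_brownian_motion_def by blast
    show ?thesis using s inc[rule_format, of "\<lambda>k. real k * s" K] by (simp add: mult_right_mono)
  qed
  then have "indep_vars (\<lambda>_. borel) ?X {..<K}"
    by (rule indep_vars_compose2) simp
  moreover have "{..<K} \<noteq> {}" using K by auto
  ultimately have "distr N (PiM {..<K} (\<lambda>_. borel)) (\<lambda>\<omega>. \<lambda>k\<in>{..<K}. ?X k \<omega>) = PiM {..<K} (\<lambda>k. distr N borel (?X k))"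
    using indep_vars_iff_distr_eq_PiM[where I="{..<K}" and M'="\<lambda>_. borel" and X="?X"] Xm by blast
  also have "\<dots> = PiM {..<K} (\<lambda>_. gauss (v * s))"
  proof (rule PiM_cong)
    fix k
    have "0 \<le> real k * s" "real k * s < real (Suc k) * s" using s by simp_all
    from brownian_increment_distr[OF W v this]
    show "distr N borel (?X k) = gauss (v * s)" by (simp add: algebra_simps)
  qed simp
  finally have eq: "PiM {..<K} (\<lambda>_. gauss (v * s)) = distr N (PiM {..<K} (\<lambda>_. borel)) (\<lambda>\<omega>. \<lambda>k\<in>{..<K}. ?X k \<omega>)" ..
  show ?thesis unfolding eq
    by (rule integral_distr[OF _ h, symmetric]) (intro measurable_restrict Xm)
qed

section \<open>Oscillation inside a block\<close>

definition oscillates :: "real \<Rightarrow> (nat \<Rightarrow> nat) \<Rightarrow> real \<Rightarrow> nat \<Rightarrow> int list \<Rightarrow> bool" where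
  "oscillates d N \<delta> k l \<longleftrightarrow> (\<exists>j. N k \<le> j \<and> j \<le> N (Suc k) \<and>
     \<delta> \<le> d * \<bar>real_of_int (sum_list (take j l) - sum_list (take (N k) l))\<bar>)"

text \<open>By the Markov property the walk after step \<open>N k\<close> is a fresh walk, and only its first
  \<open>N (Suc k) - N k\<close> steps matter; \<open>walk_maximal\<close> applies to them.\<close>

lemma prob_oscillates:
  assumes p: "0 \<le> p" "p \<le> 1/2" and y: "y \<in> {-1, 1}" and N: "mono N" and k: "k < K" and d: "0 < d" "d < \<delta>"
  shows "measure_pmf.prob (steps p (N K) y) {l. oscillates d N \<delta> k l}
     \<le> (8 * (real (N (Suc k) - N k) * step_var p)\<^sup>2 + 3 * real (N (Suc k) - N k) * step_var p) / (\<delta> / d - 1) ^ 4"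
    (is "_ \<le> ?B")
proof -
  define n where "n = N (Suc k) - N k"
  define b where "b = N K - N (Suc k)"
  have le: "N k \<le> N (Suc k)" "N (Suc k) \<le> N K" using N k by (auto simp: mono_def)
  have NK: "N K = N k + (n + b)" using le by (simp add: n_def b_def)
  define E where "E = {l. \<exists>j\<le>n. \<delta> / d \<le> \<bar>real_of_int (sum_list (take j l))\<bar>}"
  have osc: "oscillates d N \<delta> k (l @ l') \<longleftrightarrow> take n l' \<in> E" if l: "length l = N k" for l l'
  proof -
    have "oscillates d N \<delta> k (l @ l') \<longleftrightarrow> (\<exists>j\<le>n. \<delta> \<le> d * \<bar>real_of_int (sum_list (take j l'))\<bar>)"
    proof
      assume "oscillates d N \<delta> k (l @ l')"
      then obtain j where j: "N k \<le> j" "j \<le> N (Suc k)" "\<delta> \<le> d * \<bar>real_of_int (sum_list (take j (l @ l')) - sum_list (take (N k) (l @ l')))\<bar>"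
        by (auto simp: oscillates_def)
      show "\<exists>j\<le>n. \<delta> \<le> d * \<bar>real_of_int (sum_list (take j l'))\<bar>"
        using j l by (intro exI[of _ "j - N k"]) (auto simp: n_def)
    next
      assume "\<exists>j\<le>n. \<delta> \<le> d * \<bar>real_of_int (sum_list (take j l'))\<bar>"
      then obtain j where j: "j \<le> n" "\<delta> \<le> d * \<bar>real_of_int (sum_list (take j l'))\<bar>" by blast
      show "oscillates d N \<delta> k (l @ l')"
        unfolding oscillates_def using j l le by (intro exI[of _ "N k + j"]) (auto simp: n_def)
    qed
    also have "\<dots> \<longleftrightarrow> take n l' \<in> E"
      using d by (auto simp: E_def field_simps min_absorb1)
    finally show ?thesis .
  qed
  have block: "measure_pmf.expectation (steps p (n + b) z) (\<lambda>l'. indicator E (take n l')) \<le> ?B" if z: "z \<in> {-1, 1}" for z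
  proof -
    have "measure_pmf.expectation (steps p (n + b) z) (\<lambda>l'. indicator E (take n l') :: real)
       = measure_pmf.expectation (steps p n z) (indicator E)"
      unfolding expectation_steps_add
      by (intro integral_cong_AE AE_pmfI) (simp_all add: set_pmf_steps[THEN conjunct1])
    also have "\<dots> = measure_pmf.prob (steps p n z) E" by simp
    also have "\<dots> \<le> ?B"
      unfolding E_def n_def[symmetric] using d by (intro walk_maximal[OF p z]) simp
    finally show ?thesis .
  qed
  have "measure_pmf.prob (steps p (N K) y) {l. oscillates d N \<delta> k l}
     = measure_pmf.expectation (steps p (N K) y) (indicator {l. oscillates d N \<delta> k l})" by simp
  also have "\<dots> = measure_pmf.expectation (steps p (N k) y) (\<lambda>l. measure_pmf.expectation (steps p (n + b) (last (y # l)))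
       (\<lambda>l'. indicator {l. oscillates d N \<delta> k l} (l @ l')))"
    unfolding NK by (rule expectation_steps_add)
  also have "\<dots> \<le> norm \<dots>" by simp
  also have "\<dots> \<le> ?B"
  proof (rule pmf_expectation_norm_le[OF finite_set_pmf_steps])
    fix l assume l: "l \<in> set_pmf (steps p (N k) y)"
    have len: "length l = N k" using set_pmf_steps[OF l] by simp
    have "(\<lambda>l'. indicator {l. oscillates d N \<delta> k l} (l @ l') :: real) = (\<lambda>l'. indicator E (take n l'))"
      using osc[OF len] by (auto simp: indicator_def)
    then show "norm (measure_pmf.expectation (steps p (n + b) (last (y # l)))
       (\<lambda>l'. indicator {l. oscillates d N \<delta> k l} (l @ l') :: real)) \<le> ?B"
      using block[OF last_steps[OF l y]] by simp
  qed
  finally show ?thesis .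
qed

section \<open>Comparison of the walk with its values on a coarse grid\<close>

text \<open>The last step of the walk that is made by the time \<open>k * s\<close>.\<close>

definition grid :: "real \<Rightarrow> real \<Rightarrow> nat \<Rightarrow> nat" where
  "grid dt s k = nat \<lfloor>real k * s / dt\<rfloor>"

lemma grid_0 [simp]: "grid dt s 0 = 0"
  by (simp add: grid_def)

lemma mono_grid: "dt > 0 \<Longrightarrow> s > 0 \<Longrightarrow> mono (grid dt s)"
  by (auto intro!: monoI nat_mono floor_mono divide_right_mono mult_right_mono simp: grid_def)

lemma grid_bounds:
  assumes "dt > 0" "s > 0"
  shows "real k * s - dt \<le> real (grid dt s k) * dt" "real (grid dt s k) * dt \<le> real k * s"
proof -
  have "0 \<le> real k * s / dt" using assms by simp
  then have "real (grid dt s k) \<le> real k * s / dt" "real k * s / dt - 1 \<le> real (grid dt s k)"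
    unfolding grid_def by linarith+
  then show "real k * s - dt \<le> real (grid dt s k) * dt" "real (grid dt s k) * dt \<le> real k * s"
    using assms by (simp_all add: field_simps)
qed

lemma grid_scaled_limit:
  assumes dt: "\<And>i. dt i > 0" "dt \<longlonglongrightarrow> 0" and s: "s > 0"
  shows "(\<lambda>i. real (grid (dt i) s (Suc k) - grid (dt i) s k) * dt i) \<longlonglongrightarrow> s"
proof -
  have "(\<lambda>i. real (grid (dt i) s k) * dt i) \<longlonglongrightarrow> real k * s" for k
  proof (rule tendsto_sandwich[where f="\<lambda>i. real k * s - dt i" and h="\<lambda>_. real k * s"])
    show "(\<lambda>i. real k * s - dt i) \<longlonglongrightarrow> real k * s" using tendsto_diff[OF tendsto_const dt(2)] by simp
  qed (auto intro!: always_eventually grid_bounds dt s)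
  from tendsto_diff[OF this[of "Suc k"] this[of k]]
  have "(\<lambda>i. real (grid (dt i) s (Suc k)) * dt i - real (grid (dt i) s k) * dt i) \<longlonglongrightarrow> s"
    by (simp add: algebra_simps)
  moreover have "real (grid (dt i) s (Suc k) - grid (dt i) s k) * dt i
      = real (grid (dt i) s (Suc k)) * dt i - real (grid (dt i) s k) * dt i" for i
    using mono_grid[OF dt(1) s, THEN monoD, of k "Suc k" i] by (simp add: left_diff_distrib of_nat_diff)
  ultimately show ?thesis by simp
qed

text \<open>The path with increment \<open>u k\<close> over the block \<open>{k * s..(k + 1) * s}\<close>. The sum stops at \<open>K\<close> so that only
  the coordinates below \<open>K\<close> matter: in a product space over \<open>{..<K}\<close> the others are undefined.\<close>

definition path_at :: "real \<Rightarrow> nat \<Rightarrow> (nat \<Rightarrow> real) \<Rightarrow> cpath" where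
  "path_at s K u = path_of (linear_interpolation s (\<lambda>k. \<Sum>j<min k K. u j))"

lemma sum_incr:
  assumes "N 0 = 0"
  shows "(\<Sum>j<k. incr d N l j) = d * real_of_int (sum_list (take (N k) l))"
  by (induction k) (simp_all add: incr_def assms algebra_simps)

lemma walk_eq_trajectory:
  assumes "j \<le> n" shows "walk Y j \<omega> = Y 0 \<omega> + sum_list (take j (trajectory Y n \<omega>))"
  using assms
proof (induction j)
  case (Suc j)
  then have "take (Suc j) (trajectory Y n \<omega>) = take j (trajectory Y n \<omega>) @ [Y (Suc j) \<omega>]"
    by (simp add: trajectory_def take_map take_Suc_conv_app_nth)
  then show ?case using Suc by (simp add: walk_def)
qed (simp add: walk_def)

text \<open>At a time in block \<open>k\<close> both paths are compared with the value at the start of the block. The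
  term \<open>2 * d\<close> accounts for the initial state, which \<open>trajectory\<close> omits, and for the step of the
  walk that is in progress.\<close>

lemma walk_close_to_grid:
  assumes dt: "dt > 0" and s: "s > 0" and d: "d > 0" and \<delta>: "\<delta> > 0"
    and Y: "\<And>i. Y i \<omega> \<in> {-1, 1}"
    and K: "K = Suc n" and t: "0 \<le> t" "t \<le> real n * s"
    and good: "\<And>k. k < K \<Longrightarrow> \<not> oscillates d (grid dt s) \<delta> k (trajectory Y (grid dt s K) \<omega>)"
  shows "\<bar>path_val (path_of (\<lambda>t. interpolated_walk d dt Y t \<omega>)) t
     - path_val (path_at s K (restrict (incr d (grid dt s) (trajectory Y (grid dt s K) \<omega>)) {..<K})) t\<bar> \<le> 2 * \<delta> + 2 * d"
proof -
  define N where "N = grid dt s"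
  define l where "l = trajectory Y (N K) \<omega>"
  define x where "x k = d * real_of_int (sum_list (take (N k) l))" for k
  define k where "k = nat \<lfloor>t / s\<rfloor>"
  define j where "j = nat \<lfloor>t / dt\<rfloor>"
  have mN: "mono N" unfolding N_def using mono_grid[OF dt s] .
  have "t / s \<le> real n" using t s by (simp add: field_simps)
  then have "\<lfloor>t / s\<rfloor> \<le> int n" by linarith
  then have k: "k < K" by (simp add: k_def K)
  have ks: "real k \<le> t / s" "t / s < real (Suc k)" 
  proof -
    have "0 \<le> t / s" using t s by simp
    then show "real k \<le> t / s" "t / s < real (Suc k)" unfolding k_def by linarith+
  qed
  have "real k * s \<le> t" "t \<le> real (Suc k) * s" using ks s by (simp_all add: field_simps)
  then have j: "N k \<le> j" "j \<le> N (Suc k)"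
    unfolding N_def grid_def j_def using dt by (auto intro!: nat_mono floor_mono divide_right_mono)
  have jK: "j \<le> N K" using j(2) mN k by (meson Suc_leI monoD order_trans)
  have osc: "d * \<bar>real_of_int (sum_list (take i l) - sum_list (take (N k) l))\<bar> \<le> \<delta>" if "N k \<le> i" "i \<le> N (Suc k)" for i
    using good[OF k] that unfolding oscillates_def N_def[symmetric] l_def[symmetric] by (meson linear)
  have Ya: "\<bar>real_of_int (Y i \<omega>)\<bar> \<le> 1" for i using Y[of i] by auto
  have zj: "\<bar>d * of_int (walk Y j \<omega>) - x k\<bar> \<le> \<delta> + d"
  proof -
    have "d * of_int (walk Y j \<omega>) - x k = d * of_int (Y 0 \<omega>) + d * real_of_int (sum_list (take j l) - sum_list (take (N k) l))"
      unfolding walk_eq_trajectory[OF jK] l_def[symmetric] x_def by (simp add: algebra_simps)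
    moreover have "\<bar>d * of_int (Y 0 \<omega>)\<bar> \<le> d" using Ya[of 0] d by (simp add: abs_mult)
    moreover have "\<bar>d * real_of_int (sum_list (take j l) - sum_list (take (N k) l))\<bar> \<le> \<delta>"
      using osc[OF j] d by (simp add: abs_mult)
    ultimately show ?thesis by linarith
  qed
  have zSj: "\<bar>d * of_int (walk Y (Suc j) \<omega>) - x k\<bar> \<le> \<delta> + 2 * d"
  proof -
    have "d * of_int (walk Y (Suc j) \<omega>) = d * of_int (walk Y j \<omega>) + d * of_int (Y (Suc j) \<omega>)"
      by (simp add: walk_def algebra_simps)
    moreover have "\<bar>d * of_int (Y (Suc j) \<omega>)\<bar> \<le> d" using Ya[of "Suc j"] d by (simp add: abs_mult)
    ultimately show ?thesis using zj by linarith
  qed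
  have 1: "\<bar>interpolated_walk d dt Y t \<omega> - x k\<bar> \<le> \<delta> + 2 * d"
    unfolding interpolated_walk_def
    by (rule linear_interpolation_near[OF dt t(1) j_def]) (use zj zSj d in auto)
  have node: "(\<Sum>j<min i K. restrict (incr d N l) {..<K} j) = x i" if "i \<le> K" for i
  proof -
    have "(\<Sum>j<min i K. restrict (incr d N l) {..<K} j) = (\<Sum>j<i. incr d N l j)"
      using that by (intro sum.cong) auto
    then show ?thesis by (simp add: sum_incr x_def N_def)
  qed
  have 2: "\<bar>linear_interpolation s (\<lambda>i. \<Sum>j<min i K. restrict (incr d N l) {..<K} j) t - x k\<bar> \<le> \<delta>"
  proof (rule linear_interpolation_near[OF s t(1) k_def])
    show "\<bar>(\<Sum>j<min k K. restrict (incr d N l) {..<K} j) - x k\<bar> \<le> \<delta>" using node[of k] k \<delta> by simp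
    have "\<bar>x (Suc k) - x k\<bar> \<le> \<delta>"
      using osc[of "N (Suc k)"] mN d unfolding x_def by (simp add: mono_def abs_mult flip: right_diff_distrib)
    then show "\<bar>(\<Sum>j<min (Suc k) K. restrict (incr d N l) {..<K} j) - x k\<bar> \<le> \<delta>" using node[of "Suc k"] k by simp
  qed
  have "continuous_on {0..} (\<lambda>t. interpolated_walk d dt Y t \<omega>)"
    unfolding interpolated_walk_def by (rule continuous_on_linear_interpolation[OF dt])
  then have "path_val (path_of (\<lambda>t. interpolated_walk d dt Y t \<omega>)) t = interpolated_walk d dt Y t \<omega>"
    using t(1) by (rule path_val_path_of)
  moreover have "path_val (path_at s K (restrict (incr d N l) {..<K})) t
     = linear_interpolation s (\<lambda>i. \<Sum>j<min i K. restrict (incr d N l) {..<K} j) t"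
    unfolding path_at_def using t by (intro path_val_path_of continuous_on_linear_interpolation[OF s])
  ultimately show ?thesis unfolding N_def[symmetric] l_def[symmetric] using 1 2 by linarith
qed

section \<open>Convergence along a sequence\<close>

lemma path_at_measurable:
  assumes \<phi>: "path_lipschitz T L \<phi>" "L \<ge> 0" and s: "s > 0"
  shows "(\<lambda>u. \<phi> (path_at s K u)) \<in> borel_measurable (PiM {..<K} (\<lambda>_. borel))"
  unfolding path_at_def
proof (rule measurable_compose[OF _ lipschitz_interpolation_measurable[OF \<phi> s]], rule measurable_coordinatewise_then_product)
  fix k
  show "(\<lambda>u. \<Sum>j<min k K. u j) \<in> borel_measurable (PiM {..<K} (\<lambda>_. borel :: real measure))"
    by (intro borel_measurable_sum measurable_component_singleton) auto
qed

lemma path_at_lipschitz: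
  assumes \<phi>: "path_lipschitz T L \<phi>" and s: "s > 0"
  shows "\<bar>\<phi> (path_at s K (u(k := z))) - \<phi> (path_at s K u)\<bar> \<le> L * \<bar>z - u k\<bar>"
proof (rule path_lipschitzD[OF \<phi>])
  fix t assume t: "0 \<le> t" "t \<le> T"
  obtain n where "t / s \<le> real n" using real_arch_simple by blast
  then have n: "t \<le> real n * s" using s by (simp add: field_simps)
  have "\<bar>(\<Sum>j<i. (u(k := z)) j) - (\<Sum>j<i. u j)\<bar> \<le> \<bar>z - u k\<bar>" for i
  proof -
    have "(\<Sum>j<i. (u(k := z)) j) = (\<Sum>j<i. u j + (if j = k then z - u k else 0))"
      by (intro sum.cong) auto
    also have "\<dots> = (\<Sum>j<i. u j) + (if k < i then z - u k else 0)"
      by (simp add: sum.distrib)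
    finally show ?thesis by simp
  qed
  then have "\<bar>linear_interpolation s (\<lambda>i. \<Sum>j<min i K. (u(k := z)) j) t - linear_interpolation s (\<lambda>i. \<Sum>j<min i K. u j) t\<bar> \<le> \<bar>z - u k\<bar>"
    by (intro linear_interpolation_close[OF s t(1) n])
  then show "\<bar>path_val (path_at s K (u(k := z))) t - path_val (path_at s K u) t\<bar> \<le> \<bar>z - u k\<bar>"
    unfolding path_at_def by (simp only: path_val_path_of[OF continuous_on_linear_interpolation[OF s] t(1)])
qed

lemma interpolated_walk_measurable:
  assumes "\<And>n. Y n \<in> M \<rightarrow>\<^sub>M count_space S"
  shows "interpolated_walk d dt Y t \<in> borel_measurable M"
proof -
  have "(\<lambda>\<omega>. real_of_int (Y n \<omega>)) \<in> borel_measurable M" for n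
    by (rule measurable_compose[OF measurable_to_count_space_UNIV[OF assms]]) simp
  then have "(\<lambda>\<omega>. real_of_int (walk Y n \<omega>)) \<in> borel_measurable M" for n
    unfolding walk_def of_int_sum by (rule borel_measurable_sum)
  note this[measurable]
  show ?thesis
    unfolding interpolated_walk_def[abs_def] linear_interpolation_def Let_def by measurable
qed

text \<open>Without a large oscillation the two paths are uniformly close; otherwise the difference is at
  most \<open>2 * C\<close>, and a union bound over the blocks remains.\<close>

lemma walk_functional_near_grid:
  assumes c0: "c0 < 0" and d: "d > 0" "- c0 * d \<le> 1/2" and dt: "dt > 0" and s: "s > 0"
    and mc: "markov_chain M {-1, 1} (persistent_matrix c0 d) Y"
    and Y0: "AE \<omega> in M. Y 0 \<omega> = y0" and y0: "y0 \<in> {-1, 1}"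
    and K: "K = Suc n" and T: "T = real n * s" and \<delta>: "\<delta> > d"
    and \<phi>: "path_lipschitz T L \<phi>" "L \<ge> 0" "\<And>f. \<bar>\<phi> f\<bar> \<le> C"
  defines "N \<equiv> grid dt s" and "p \<equiv> - c0 * d"
  shows "\<bar>(\<integral>\<omega>. \<phi> (path_of (\<lambda>t. interpolated_walk d dt Y t \<omega>)) \<partial>M)
       - measure_pmf.expectation (steps p (N K) y0) (\<lambda>l. \<phi> (path_at s K (restrict (incr d N l) {..<K})))\<bar>
     \<le> L * (2 * \<delta> + 2 * d) + 2 * C * (\<Sum>k<K. (8 * (real (N (Suc k) - N k) * step_var p)\<^sup>2 + 3 * real (N (Suc k) - N k) * step_var p) / (\<delta> / d - 1) ^ 4)"
proof -
  interpret prob_space M using mc by (simp add: markov_chain_def)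
  have Ym: "\<And>n. Y n \<in> M \<rightarrow>\<^sub>M count_space {-1, 1}" using mc by (simp add: markov_chain_def)
  have Yv: "Y i \<omega> \<in> {-1, 1}" if "\<omega> \<in> space M" for i \<omega>
    using measurable_space[OF Ym that] by simp
  have p: "0 \<le> p" "p \<le> 1/2" using c0 d by (simp_all add: p_def mult_nonpos_nonneg)
  have C: "C \<ge> 0" using \<phi>(3)[of undefined] by linarith
  let ?tr = "trajectory Y (N K)"
  note [measurable] = measurable_trajectory[OF Ym, where n="N K"]
  \<comment> \<open>From here on, expectations of functions of the trajectory are computed in the tree of steps.\<close>
  have transfer: "(\<integral>\<omega>. g (?tr \<omega>) \<partial>M) = measure_pmf.expectation (steps p (N K) y0) g" for g :: "int list \<Rightarrow> real"
  proof -
    have "(\<integral>\<omega>. g (?tr \<omega>) \<partial>M) = integral\<^sup>L (distr M (count_space UNIV) ?tr) g"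
      by (rule integral_distr[symmetric]) simp_all
    then show ?thesis using distr_trajectory[OF mc Y0 y0 p_def[THEN meta_eq_to_obj_eq] p(1)] p(2) by simp
  qed
  have tm: "(\<lambda>\<omega>. g (?tr \<omega>)) \<in> borel_measurable M" for g :: "int list \<Rightarrow> real"
    by (rule measurable_compose[OF measurable_trajectory[OF Ym]]) simp
  define F where "F \<omega> = \<phi> (path_of (\<lambda>t. interpolated_walk d dt Y t \<omega>))" for \<omega>
  define H where "H l = \<phi> (path_at s K (restrict (incr d N l) {..<K}))" for l
  define b where "b k l = (indicator {l. oscillates d N \<delta> k l} l :: real)" for k l
  have cont: "continuous_on {0..} (\<lambda>t. interpolated_walk d dt Y t \<omega>)" for \<omega>
    unfolding interpolated_walk_def by (rule continuous_on_linear_interpolation[OF dt])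
  have Fm: "F \<in> borel_measurable M"
    unfolding F_def by (rule integral_path_law(2)[OF interpolated_walk_measurable[OF Ym] cont \<phi>(1,2)])
  have Fi: "integrable M F" using Fm \<phi>(3) by (intro integrable_bounded_prob[OF prob_space_axioms, where C=C]) (auto simp: F_def)
  have Hi: "integrable M (\<lambda>\<omega>. H (?tr \<omega>))"
    using tm \<phi>(3) by (intro integrable_bounded_prob[OF prob_space_axioms, where C=C]) (auto simp: H_def)
  have bi: "integrable M (\<lambda>\<omega>. b k (?tr \<omega>))" for k
    using tm by (intro integrable_bounded_prob[OF prob_space_axioms, where C=1]) (auto simp: b_def indicator_def)
  have pt: "\<bar>F \<omega> - H (?tr \<omega>)\<bar> \<le> L * (2 * \<delta> + 2 * d) + 2 * C * (\<Sum>k<K. b k (?tr \<omega>))" if \<omega>: "\<omega> \<in> space M" for \<omega>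
  proof (cases "\<exists>k<K. oscillates d N \<delta> k (?tr \<omega>)")
    case False
    have "\<bar>F \<omega> - H (?tr \<omega>)\<bar> \<le> L * (2 * \<delta> + 2 * d)"
      unfolding F_def H_def
    proof (rule path_lipschitzD[OF \<phi>(1)], goal_cases)
      case (1 t)
      then show ?case unfolding N_def
        by (intro walk_close_to_grid[where Y=Y and \<omega>=\<omega>, OF dt s d(1) _ Yv[OF \<omega>] K]) (use False \<delta> d T N_def in auto)
    qed
    moreover have "0 \<le> (\<Sum>k<K. b k (?tr \<omega>))" by (intro sum_nonneg) (simp add: b_def)
    ultimately show ?thesis using C by (smt (verit) mult_nonneg_nonneg)
  next
    case True
    then obtain k where k: "k < K" "oscillates d N \<delta> k (?tr \<omega>)" by blast
    have "1 = b k (?tr \<omega>)" using k by (simp add: b_def)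
    also have "\<dots> \<le> (\<Sum>k<K. b k (?tr \<omega>))" using k by (intro member_le_sum) (auto simp: b_def)
    finally have "2 * C * 1 \<le> 2 * C * (\<Sum>k<K. b k (?tr \<omega>))" using C by (intro mult_left_mono) auto
    moreover have "\<bar>F \<omega> - H (?tr \<omega>)\<bar> \<le> 2 * C" 
    proof -
      have "\<bar>F \<omega>\<bar> \<le> C" "\<bar>H (?tr \<omega>)\<bar> \<le> C" by (simp_all only: F_def H_def \<phi>(3))
      then show ?thesis by linarith
    qed
    moreover have "0 \<le> L * (2 * \<delta> + 2 * d)" using \<phi>(2) \<delta> d by simp
    ultimately show ?thesis by linarith
  qed
  have "\<bar>(\<integral>\<omega>. F \<omega> \<partial>M) - measure_pmf.expectation (steps p (N K) y0) H\<bar> = \<bar>\<integral>\<omega>. F \<omega> - H (?tr \<omega>) \<partial>M\<bar>"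
    unfolding transfer[symmetric] Bochner_Integration.integral_diff[OF Fi Hi] ..
  also have "\<dots> \<le> (\<integral>\<omega>. \<bar>F \<omega> - H (?tr \<omega>)\<bar> \<partial>M)" by (rule integral_abs_bound)
  also have "\<dots> \<le> (\<integral>\<omega>. L * (2 * \<delta> + 2 * d) + 2 * C * (\<Sum>k<K. b k (?tr \<omega>)) \<partial>M)"
    using pt Fi Hi bi by (intro integral_mono integrable_abs Bochner_Integration.integrable_diff Bochner_Integration.integrable_add
      integrable_mult_right Bochner_Integration.integrable_sum) auto
  also have "\<dots> = L * (2 * \<delta> + 2 * d) + 2 * C * (\<Sum>k<K. measure_pmf.expectation (steps p (N K) y0) (b k))"
    using bi by (simp add: transfer prob_space)
  also have "\<dots> \<le> L * (2 * \<delta> + 2 * d) + 2 * C * (\<Sum>k<K. (8 * (real (N (Suc k) - N k) * step_var p)\<^sup>2 + 3 * real (N (Suc k) - N k) * step_var p) / (\<delta> / d - 1) ^ 4)"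
  proof (intro add_left_mono mult_left_mono sum_mono)
    fix k assume "k \<in> {..<K}"
    then show "measure_pmf.expectation (steps p (N K) y0) (b k) \<le> (8 * (real (N (Suc k) - N k) * step_var p)\<^sup>2 + 3 * real (N (Suc k) - N k) * step_var p) / (\<delta> / d - 1) ^ 4"
      using prob_oscillates[OF p y0 _ _ d(1) \<delta>, of N k K] mono_grid[OF dt s] by (simp add: b_def[abs_def] N_def)
  qed (use C in auto)
  finally show ?thesis unfolding F_def H_def .
qed

text \<open>After multiplying numerator and denominator by $\Delta_x^4$, the first term of the numerator is
  eight times the square of the rescaled variance of a block, and the second one is negligible.\<close>

lemma block_bound_tendsto:
  assumes c0: "c0 < 0" and d: "\<And>i. d i > 0" "d \<longlonglongrightarrow> 0" and \<delta>: "\<delta> > 0"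
    and n: "(\<lambda>i. real (n i) * d i ^ 3) \<longlonglongrightarrow> \<tau>"
  shows "(\<lambda>i. (8 * (real (n i) * step_var (- c0 * d i))\<^sup>2 + 3 * real (n i) * step_var (- c0 * d i)) / (\<delta> / d i - 1) ^ 4)
           \<longlonglongrightarrow> 8 * (- c0 * \<tau>)\<^sup>2 / \<delta> ^ 4"
proof -
  define w where "w i = - c0 / (1 + c0 * d i)" for i
  have "(\<lambda>i. 1 + c0 * d i) \<longlonglongrightarrow> 1 + c0 * 0" by (intro tendsto_intros d)
  then have wl: "w \<longlonglongrightarrow> - c0" using tendsto_divide[OF tendsto_const[of "- c0"]] by (fastforce simp: w_def[abs_def])
  have "(8 * (real (n i) * step_var (- c0 * d i))\<^sup>2 + 3 * real (n i) * step_var (- c0 * d i)) / (\<delta> / d i - 1) ^ 4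
     = (8 * ((real (n i) * d i ^ 3) * w i)\<^sup>2 + 3 * ((real (n i) * d i ^ 3) * w i * (d i)\<^sup>2)) / (\<delta> - d i) ^ 4" for i
  proof -
    have v: "step_var (- c0 * d i) = d i * w i" by (simp add: step_var_def w_def)
    have \<delta>d: "\<delta> / d i - 1 = (\<delta> - d i) / d i" using d(1)[of i] by (simp add: field_simps)
    have "(8 * (real (n i) * (d i * w i))\<^sup>2 + 3 * real (n i) * (d i * w i)) * d i ^ 4
       = 8 * ((real (n i) * d i ^ 3) * w i)\<^sup>2 + 3 * ((real (n i) * d i ^ 3) * w i * (d i)\<^sup>2)"
      by (simp add: algebra_simps power2_eq_square power3_eq_cube power4_eq_xxxx)
    then show ?thesis unfolding v \<delta>d power_divide divide_divide_eq_right by simp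
  qed
  moreover have "(\<lambda>i. (8 * ((real (n i) * d i ^ 3) * w i)\<^sup>2 + 3 * ((real (n i) * d i ^ 3) * w i * (d i)\<^sup>2)) / (\<delta> - d i) ^ 4)
     \<longlonglongrightarrow> (8 * (\<tau> * (- c0))\<^sup>2 + 3 * (\<tau> * (- c0) * 0\<^sup>2)) / (\<delta> - 0) ^ 4"
    using \<delta> by (intro tendsto_intros n wl d) auto
  ultimately show ?thesis by (simp add: mult.commute)
qed

text \<open>The Gaussian integral is the expectation of the functional at the interpolated Brownian path,
  and the interpolations converge as the mesh \<open>1 / Suc m\<close> tends to zero. The grid covers \<open>{0..T}\<close>
  by \<open>Suc m * T\<close> blocks, and one more is added because a time equal to \<open>T\<close> belongs to the block
  that starts there.\<close>

lemma brownian_functional_on_grid: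
  assumes W: "standard_brownian_motion Q W" and v: "v > 0"
    and \<phi>: "path_lipschitz (real T) L \<phi>" "L \<ge> 0" "\<And>f. \<bar>\<phi> f\<bar> \<le> C"
  shows "(\<lambda>m. \<integral>x. \<phi> (path_at (1 / real (Suc m)) (Suc (Suc m * T)) x) \<partial>PiM {..<Suc (Suc m * T)} (\<lambda>_. gauss (v * (1 / real (Suc m)))))
     \<longlonglongrightarrow> (\<integral>\<omega>. \<phi> (path_of (\<lambda>t. sqrt v * W t \<omega>)) \<partial>Q)"
proof -
  interpret prob_space Q using W by (simp add: standard_brownian_motion_def)
  have Wm: "(\<lambda>\<omega>. sqrt v * W t \<omega>) \<in> borel_measurable Q" if "t \<ge> 0" for t
  proof -
    have "W t \<in> borel_measurable Q" using W that unfolding standard_brownian_motion_def by blast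
    then show ?thesis by simp
  qed
  have Wc: "continuous_on {0..} (\<lambda>t. sqrt v * W t \<omega>)" if "\<omega> \<in> space Q" for \<omega>
    using W that by (intro continuous_intros) (simp add: standard_brownian_motion_def)
  have W0: "AE \<omega> in Q. W 0 \<omega> = 0" using W by (simp add: standard_brownian_motion_def)
  define J where "J m \<omega> = \<phi> (path_of (linear_interpolation (1 / real (Suc m)) (\<lambda>k. sqrt v * W (real k / real (Suc m)) \<omega>)))" for m \<omega>
  have Jm: "J m \<in> borel_measurable Q" for m
    unfolding J_def
    by (rule measurable_compose[OF _ lipschitz_interpolation_measurable[OF \<phi>(1,2)]],
        rule measurable_coordinatewise_then_product) (auto intro: Wm)
  have Jb: "\<bar>J m \<omega>\<bar> \<le> C" for m \<omega> by (simp only: J_def \<phi>(3))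
  have "(\<lambda>m. \<integral>\<omega>. J m \<omega> \<partial>Q) \<longlonglongrightarrow> (\<integral>\<omega>. \<phi> (path_of (\<lambda>t. sqrt v * W t \<omega>)) \<partial>Q)"
  proof (rule integral_dominated_convergence[where w="\<lambda>_. C"])
    show "(\<lambda>\<omega>. \<phi> (path_of (\<lambda>t. sqrt v * W t \<omega>))) \<in> borel_measurable Q"
      by (rule integral_path_law(2)[OF Wm Wc \<phi>(1,2)])
    show "AE \<omega> in Q. (\<lambda>m. J m \<omega>) \<longlonglongrightarrow> \<phi> (path_of (\<lambda>t. sqrt v * W t \<omega>))"
      unfolding J_def by (intro AE_I2 lipschitz_interpolation_tendsto[OF \<phi>(1,2) Wc])
  qed (simp_all add: Jm Jb)
  moreover have "(\<integral>\<omega>. J m \<omega> \<partial>Q) = (\<integral>x. \<phi> (path_at (1 / real (Suc m)) (Suc (Suc m * T)) x) \<partial>PiM {..<Suc (Suc m * T)} (\<lambda>_. gauss (v * (1 / real (Suc m)))))" for m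
  proof -
    define s where "s = 1 / real (Suc m)"
    define K where "K = Suc (Suc m * T)"
    have s: "s > 0" by (simp add: s_def)
    define I where "I \<omega> = (\<lambda>k\<in>{..<K}. sqrt v * (W (real (Suc k) * s) \<omega> - W (real k * s) \<omega>))" for \<omega>
    have "(\<integral>x. \<phi> (path_at s K x) \<partial>PiM {..<K} (\<lambda>_. gauss (v * s))) = (\<integral>\<omega>. \<phi> (path_at s K (I \<omega>)) \<partial>Q)"
      unfolding I_def by (rule brownian_increments_integral[OF W v s _ path_at_measurable[OF \<phi>(1,2) s], symmetric]) (simp add: K_def)
    also have "\<dots> = (\<integral>\<omega>. J m \<omega> \<partial>Q)"
    proof (rule integral_cong_AE)
      have "I \<in> Q \<rightarrow>\<^sub>M PiM {..<K} (\<lambda>_. borel)"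
        unfolding I_def right_diff_distrib using s by (intro measurable_restrict borel_measurable_diff Wm) auto
      then show "(\<lambda>\<omega>. \<phi> (path_at s K (I \<omega>))) \<in> borel_measurable Q"
        by (rule measurable_compose[OF _ path_at_measurable[OF \<phi>(1,2) s]])
      show "AE \<omega> in Q. \<phi> (path_at s K (I \<omega>)) = J m \<omega>"
        using W0
      proof eventually_elim
        case (elim \<omega>)
        have node: "(\<Sum>j<min k K. I \<omega> j) = sqrt v * W (real k / real (Suc m)) \<omega>" if "k \<le> K" for k
        proof -
          have "(\<Sum>j<min k K. I \<omega> j) = (\<Sum>j<k. sqrt v * W (real (Suc j) * s) \<omega> - sqrt v * W (real j * s) \<omega>)"
            using that by (intro sum.cong) (auto simp: I_def right_diff_distrib)
          also have "\<dots> = sqrt v * W (real k * s) \<omega>"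
            using elim by (subst sum_lessThan_telescope) simp
          finally show ?thesis by (simp add: s_def)
        qed
        have "\<bar>\<phi> (path_at s K (I \<omega>)) - J m \<omega>\<bar> \<le> L * 0"
          unfolding J_def path_at_def s_def[symmetric]
        proof (rule path_lipschitzD[OF \<phi>(1)])
          fix t assume t: "0 \<le> t" "t \<le> real T"
          have "real (Suc m) * s = 1" by (simp add: s_def)
          then have "real (Suc m * T) * s = real T" by (simp only: of_nat_mult mult.commute[of "real (Suc m)"] mult.assoc mult_1_right)
          then have T: "t \<le> real (Suc m * T) * s" using t by simp
          have "\<bar>linear_interpolation s (\<lambda>k. \<Sum>j<min k K. I \<omega> j) t - linear_interpolation s (\<lambda>k. sqrt v * W (real k / real (Suc m)) \<omega>) t\<bar> \<le> 0"
          proof (rule linear_interpolation_close[OF s t(1) T])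
            fix k assume "k \<le> Suc (Suc m * T)"
            then have "k \<le> K" by (simp only: K_def)
            then show "\<bar>(\<Sum>j<min k K. I \<omega> j) - sqrt v * W (real k / real (Suc m)) \<omega>\<bar> \<le> 0"
              by (simp only: node diff_self abs_zero order_refl)
          qed
          then show "\<bar>path_val (path_of (linear_interpolation s (\<lambda>k. \<Sum>j<min k K. I \<omega> j))) t
             - path_val (path_of (linear_interpolation s (\<lambda>k. sqrt v * W (real k / real (Suc m)) \<omega>))) t\<bar> \<le> 0"
            by (simp only: path_val_path_of[OF continuous_on_linear_interpolation[OF s] t(1)])
        qed
        then show ?case by simp
      qed
    qed (rule Jm)
    finally show ?thesis unfolding s_def K_def ..
  qed
  ultimately show ?thesis by simp
qed

text \<open>The parameters are chosen in the order oscillation level \<open>\<delta>\<close>, number \<open>Suc m\<close> of blocks per unit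
  of time, index of the sequence: only for a fixed level is the probability of a large oscillation
  in some block of the order \<open>1 / m\<close>, and only for fixed blocks do the increments converge.\<close>

lemma walk_functional_limit:
  fixes M :: "nat \<Rightarrow> 'a measure"
  assumes c0: "c0 < 0" and r: "r > 0" and d: "\<And>i. d i > 0" "\<And>i. - c0 * d i \<le> 1/2" "d \<longlonglongrightarrow> 0"
    and dt: "\<And>i. r * dt i = d i ^ 3" and y0: "y0 \<in> {-1, 1}"
    and mc: "\<And>i. markov_chain (M i) {-1, 1} (persistent_matrix c0 (d i)) (Y i)"
    and Y0: "\<And>i. AE \<omega> in M i. Y i 0 \<omega> = y0"
    and W: "standard_brownian_motion Q W"
    and \<phi>: "path_lipschitz (real T) L \<phi>" "L \<ge> 0" "\<And>f. \<bar>\<phi> f\<bar> \<le> C"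
  shows "(\<lambda>i. \<integral>\<omega>. \<phi> (path_of (\<lambda>t. interpolated_walk (d i) (dt i) (Y i) t \<omega>)) \<partial>M i)
     \<longlonglongrightarrow> (\<integral>\<omega>. \<phi> (path_of (\<lambda>t. sqrt (- r * c0) * W t \<omega>)) \<partial>Q)" (is "?F \<longlonglongrightarrow> ?b")
proof (rule tendstoI)
  fix \<epsilon> :: real assume \<epsilon>: "\<epsilon> > 0"
  then have \<epsilon>5: "\<epsilon> / 5 > 0" by simp
  define v where "v = - r * c0"
  have v: "v > 0" using r c0 by (simp add: v_def mult_pos_neg)
  have C: "C \<ge> 0" using \<phi>(3)[of undefined] by linarith
  have dtv: "dt i = d i ^ 3 / r" for i using dt[of i] r by (simp add: field_simps)
  have dt0: "dt i > 0" for i using d(1)[of i] r by (simp add: dtv)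
  have dtl: "dt \<longlonglongrightarrow> 0" using r tendsto_divide[OF tendsto_power[OF d(3), of 3] tendsto_const[of r]] by (simp add: dtv[abs_def])
  define \<delta> where "\<delta> = \<epsilon> / (10 * (L + 1))"
  have \<delta>: "\<delta> > 0" using \<epsilon> \<phi>(2) by (simp add: \<delta>_def)
  have "10 * (L + 1) * \<delta> = \<epsilon>" using \<phi>(2) by (simp add: \<delta>_def)
  then have L\<delta>: "L * (2 * \<delta>) < \<epsilon> / 5" using \<delta> by (simp add: algebra_simps)
  define A where "A m = (\<integral>x. \<phi> (path_at (1 / real (Suc m)) (Suc (Suc m * T)) x) \<partial>PiM {..<Suc (Suc m * T)} (\<lambda>_. gauss (v * (1 / real (Suc m)))))" for m
  have "A \<longlonglongrightarrow> ?b" unfolding A_def v_def[symmetric] by (rule brownian_functional_on_grid[OF W v \<phi>])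
  then have Ab: "\<forall>\<^sub>F m in sequentially. \<bar>A m - ?b\<bar> < \<epsilon> / 5"
    unfolding tendsto_iff dist_real_def using \<epsilon>5 by blast
  \<comment> \<open>The number of blocks grows like \<open>m\<close> while the bound for one block decays like \<open>1 / m\<^sup>2\<close>.\<close>
  have "(\<lambda>m. 2 * C * (8 * v\<^sup>2 / \<delta> ^ 4) * (real T * inverse (real (Suc m)) + (inverse (real (Suc m)))\<^sup>2))
     \<longlonglongrightarrow> 2 * C * (8 * v\<^sup>2 / \<delta> ^ 4) * (real T * 0 + 0\<^sup>2)"
    by (intro tendsto_intros LIMSEQ_inverse_real_of_nat)
  then have "\<forall>\<^sub>F m in sequentially. 2 * C * (8 * v\<^sup>2 / \<delta> ^ 4) * (real T * inverse (real (Suc m)) + (inverse (real (Suc m)))\<^sup>2) < \<epsilon> / 5"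
    using \<epsilon> by (intro order_tendstoD) auto
  from eventually_happens[OF eventually_conj[OF Ab this]] obtain m where m: "\<bar>A m - ?b\<bar> < \<epsilon> / 5"
    "2 * C * (8 * v\<^sup>2 / \<delta> ^ 4) * (real T * inverse (real (Suc m)) + (inverse (real (Suc m)))\<^sup>2) < \<epsilon> / 5"
    by auto
  define s where "s = 1 / real (Suc m)"
  define K where "K = Suc (Suc m * T)"
  have s: "s > 0" by (simp add: s_def)
  define N where "N i = grid (dt i) s" for i
  define B where "B i = measure_pmf.expectation (steps (- c0 * d i) (N i K) y0) (\<lambda>l. \<phi> (path_at s K (restrict (incr (d i) (N i) l) {..<K})))" for i
  define R where "R i = L * (2 * \<delta> + 2 * d i) + 2 * C * (\<Sum>k<K. (8 * (real (N i (Suc k) - N i k) * step_var (- c0 * d i))\<^sup>2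
       + 3 * real (N i (Suc k) - N i k) * step_var (- c0 * d i)) / (\<delta> / d i - 1) ^ 4)" for i
  have Nl: "(\<lambda>i. real (N i (Suc k) - N i k) * d i ^ 3) \<longlonglongrightarrow> r * s" for k
    using tendsto_mult[OF tendsto_const[of r] grid_scaled_limit[OF dt0 dtl s, of k]]
    by (simp add: N_def flip: dt) (simp add: ac_simps)
  have "B \<longlonglongrightarrow> (\<integral>x. \<phi> (path_at s K x) \<partial>PiM {..<K} (\<lambda>_. gauss (- c0 * (r * s))))"
    unfolding B_def
  proof (rule block_increments_limit[where h="\<lambda>u. \<phi> (path_at s K u)" and N=N, OF c0 d(1,3) y0 _ _ Nl _ _ _ C \<phi>(2)])
    show "(\<lambda>u. \<phi> (path_at s K u)) \<in> borel_measurable (PiM {..<K} (\<lambda>_. borel))"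
      by (rule path_at_measurable[OF \<phi>(1,2) s])
    show "\<bar>\<phi> (path_at s K (x(k := z))) - \<phi> (path_at s K x)\<bar> \<le> L * \<bar>z - x k\<bar>" for x k z
      by (rule path_at_lipschitz[OF \<phi>(1) s])
  qed (auto simp: N_def mono_grid[OF dt0 s] \<phi>(3))
  also have "(\<integral>x. \<phi> (path_at s K x) \<partial>PiM {..<K} (\<lambda>_. gauss (- c0 * (r * s)))) = A m"
    by (simp add: A_def s_def K_def v_def ac_simps)
  finally have Bl: "\<forall>\<^sub>F i in sequentially. \<bar>B i - A m\<bar> < \<epsilon> / 5"
    unfolding tendsto_iff dist_real_def using \<epsilon>5 by blast
  have "R \<longlonglongrightarrow> L * (2 * \<delta> + 2 * 0) + 2 * C * (\<Sum>k<K. 8 * (- c0 * (r * s))\<^sup>2 / \<delta> ^ 4)"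
    unfolding R_def by (intro tendsto_intros d(3) block_bound_tendsto[OF c0 d(1,3) \<delta> Nl])
  moreover have "L * (2 * \<delta> + 2 * 0) + 2 * C * (\<Sum>k<K. 8 * (- c0 * (r * s))\<^sup>2 / \<delta> ^ 4) < 2 * \<epsilon> / 5"
  proof -
    have "real K * s\<^sup>2 = real T * inverse (real (Suc m)) + (inverse (real (Suc m)))\<^sup>2"
    proof -
      have 1: "real (Suc m) * s = 1" by (simp add: s_def)
      have "real K = real T * real (Suc m) + 1" by (simp add: K_def algebra_simps)
      then have "real K * s\<^sup>2 = real T * (real (Suc m) * s) * s + s\<^sup>2"
        by (simp only: power2_eq_square distrib_right mult_1_left mult.assoc)
      then have "real K * s\<^sup>2 = real T * s + s\<^sup>2" unfolding 1 by (simp only: mult_1_right)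
      then show ?thesis unfolding s_def inverse_eq_divide .
    qed
    moreover have "2 * C * (\<Sum>k<K. 8 * (- c0 * (r * s))\<^sup>2 / \<delta> ^ 4) = 2 * C * (8 * v\<^sup>2 / \<delta> ^ 4) * (real K * s\<^sup>2)"
      by (simp add: v_def power_mult_distrib)
    ultimately have "2 * C * (\<Sum>k<K. 8 * (- c0 * (r * s))\<^sup>2 / \<delta> ^ 4) < \<epsilon> / 5" using m(2) by (simp only:)
    then show ?thesis using L\<delta> by (simp only: mult_zero_right add_0_right)
  qed
  ultimately have Rl: "\<forall>\<^sub>F i in sequentially. R i < 2 * \<epsilon> / 5" by (rule order_tendstoD)
  have "\<forall>\<^sub>F i in sequentially. d i < \<delta>" using order_tendstoD(2)[OF d(3) \<delta>] .
  with Bl Rl show "\<forall>\<^sub>F i in sequentially. dist (?F i) ?b < \<epsilon>"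
  proof eventually_elim
    case (elim i)
    have Ts: "real T = real (Suc m * T) * s"
      by (simp only: of_nat_mult s_def) simp
    have "\<bar>?F i - B i\<bar> \<le> R i"
      unfolding B_def R_def N_def
      by (rule walk_functional_near_grid[OF c0 d(1,2) dt0 s mc Y0 y0 _ _ _ _ \<phi>(2,3), where n="Suc m * T" and T="real T"])
         (simp only: K_def, rule Ts, rule elim, rule \<phi>(1))
    then show ?case using elim m(1) unfolding dist_real_def by linarith
  qed
qed

theorem proposition2p3:
  fixes c0 r :: real
    and dt :: "real \<Rightarrow> real"
    and M :: "real \<Rightarrow> 'a measure"
    and Y :: "real \<Rightarrow> nat \<Rightarrow> 'a \<Rightarrow> int"
    and y0 :: int
    and N :: "'b measure"
    and W :: "real \<Rightarrow> 'b \<Rightarrow> real"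
  assumes "c0 < 0" and "r > 0"
    and "\<And>dx. dx > 0 \<Longrightarrow> r * dt dx = dx ^ 3"
    and "y0 \<in> {-1, 1}"
    and "\<And>dx. dx > 0 \<Longrightarrow> 0 \<le> 1 + c0 * dx \<Longrightarrow> 1 + c0 * dx \<le> 1 \<Longrightarrow>
           markov_chain (M dx) {-1, 1} (persistent_matrix c0 dx) (Y dx)"
    and "\<And>dx. dx > 0 \<Longrightarrow> 0 \<le> 1 + c0 * dx \<Longrightarrow> 1 + c0 * dx \<le> 1 \<Longrightarrow>
           (AE \<omega> in M dx. Y dx 0 \<omega> = y0)"
    and "standard_brownian_motion N W"
  shows "weakly_converges
           (\<lambda>dx. path_law (M dx) (interpolated_walk dx (dt dx) (Y dx)))
           (path_law N (\<lambda>t \<omega>. sqrt (- r * c0) * W t \<omega>))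
           (at_right 0)"
proof -
  note c0 = assms(1) and r = assms(2) and dt = assms(3) and y0 = assms(4) and mc = assms(5) and Y0 = assms(6) and W = assms(7)
  \<comment> \<open>Up to \<open>b\<close> the matrix is stochastic and the probability of a repetition is at most \<open>1/2\<close>.\<close>
  define b where "b = 1 / (2 * - c0)"
  have b: "b > 0" using c0 by (simp add: b_def)
  have small: "0 \<le> 1 + c0 * dx" "1 + c0 * dx \<le> 1" "- c0 * dx \<le> 1/2" if "0 < dx" "dx \<le> b" for dx
  proof -
    have "- c0 * dx \<le> - c0 * b" using c0 that by (intro mult_left_mono) auto
    also have "- c0 * b = 1/2" using c0 by (simp add: b_def)
    finally show "- c0 * dx \<le> 1/2" .
    then show "0 \<le> 1 + c0 * dx" by simp
    show "1 + c0 * dx \<le> 1" using c0 that by (simp add: mult_nonpos_nonneg)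
  qed
  have dtpos: "dt dx > 0" if "dx > 0" for dx
    using dt[OF that] r that by (metis zero_less_mult_pos zero_less_power)
  have walk_meas: "interpolated_walk dx (dt dx) (Y dx) t \<in> borel_measurable (M dx)"
    and walk_prob: "prob_space (M dx)" if "0 < dx" "dx \<le> b" for dx t
    using mc[OF that(1) small(1,2)[OF that]] unfolding markov_chain_def
    by (auto intro: interpolated_walk_measurable)
  have walk_cont: "continuous_on {0..} (\<lambda>t. interpolated_walk dx (dt dx) (Y dx) t \<omega>)" if "0 < dx" for dx \<omega>
    unfolding interpolated_walk_def by (rule continuous_on_linear_interpolation[OF dtpos[OF that]])
  have N: "prob_space N" using W by (simp add: standard_brownian_motion_def)
  have W_meas: "(\<lambda>\<omega>. sqrt (- r * c0) * W t \<omega>) \<in> borel_measurable N" if "t \<ge> 0" for t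
  proof -
    have "W t \<in> borel_measurable N" using W that unfolding standard_brownian_motion_def by blast
    then show ?thesis by simp
  qed
  have W_cont: "continuous_on {0..} (\<lambda>t. sqrt (- r * c0) * W t \<omega>)" if "\<omega> \<in> space N" for \<omega>
    using W that by (intro continuous_intros) (simp add: standard_brownian_motion_def)
  show ?thesis
  proof (rule weakly_converges_lipschitzI)
    have "\<forall>\<^sub>F dx in at_right 0. 0 < dx \<and> dx \<le> b"
      using b by (auto simp: eventually_at_right_field intro!: exI[of _ b])
    then show "\<forall>\<^sub>F dx in at_right 0. prob_space (path_law (M dx) (interpolated_walk dx (dt dx) (Y dx)))
        \<and> sets (path_law (M dx) (interpolated_walk dx (dt dx) (Y dx))) = sets borel"
      by eventually_elim (auto intro!: prob_space_path_law walk_prob walk_meas walk_cont)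
    show "prob_space (path_law N (\<lambda>t \<omega>. sqrt (- r * c0) * W t \<omega>))"
      by (rule prob_space_path_law[OF N W_meas W_cont])
    show "sets (path_law N (\<lambda>t \<omega>. sqrt (- r * c0) * W t \<omega>)) = sets borel" by (rule sets_path_law)
    fix k C \<psi> assume \<psi>: "path_lipschitz (real k) (real k) \<psi>" "\<And>f. \<bar>\<psi> f\<bar> \<le> C"
    let ?G = "\<lambda>dx. integral\<^sup>L (path_law (M dx) (interpolated_walk dx (dt dx) (Y dx))) \<psi>"
    have "(?G \<longlongrightarrow> integral\<^sup>L (path_law N (\<lambda>t \<omega>. sqrt (- r * c0) * W t \<omega>)) \<psi>) (at 0 within {0..b})"
      unfolding tendsto_at_iff_sequentially
    proof (intro allI impI)
      fix d :: "nat \<Rightarrow> real" assume d: "\<forall>i. d i \<in> {0..b} - {0}" "d \<longlonglongrightarrow> 0"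
      have di: "0 < d i" "d i \<le> b" for i using d(1)[rule_format, of i] by auto
      have "(\<lambda>i. \<integral>\<omega>. \<psi> (path_of (\<lambda>t. interpolated_walk (d i) (dt (d i)) (Y (d i)) t \<omega>)) \<partial>M (d i))
         \<longlonglongrightarrow> (\<integral>\<omega>. \<psi> (path_of (\<lambda>t. sqrt (- r * c0) * W t \<omega>)) \<partial>N)"
        by (rule walk_functional_limit[OF c0 r di(1) small(3)[OF di] d(2) dt[OF di(1)] y0
              mc[OF di(1) small(1,2)[OF di]] Y0[OF di(1) small(1,2)[OF di]] W \<psi>(1) _ \<psi>(2)]) simp
      then show "(?G \<circ> d) \<longlonglongrightarrow> integral\<^sup>L (path_law N (\<lambda>t \<omega>. sqrt (- r * c0) * W t \<omega>)) \<psi>"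
        by (simp only: o_def integral_path_law(1)[OF walk_meas[OF di] walk_cont[OF di(1)] \<psi>(1) of_nat_0_le_iff]
              integral_path_law(1)[OF W_meas W_cont \<psi>(1) of_nat_0_le_iff])
    qed
    then show "(?G \<longlongrightarrow> integral\<^sup>L (path_law N (\<lambda>t \<omega>. sqrt (- r * c0) * W t \<omega>)) \<psi>) (at_right 0)"
      using at_within_Icc_at_right[OF b] by simp
  qed
qed

end
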